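(* Let $A\in\mathbb R^{d\times d}$ be invertible, $Q=Q^\top\succ0$, $R=R^\top\succ0$, $(A,B)$ stabilizable, and let the terminal reward be $r_S(x)=\tfrac12x^\top Sx$ with $S=S^\top\preceq0$. For the unconstrained problem (or where its optimizer is interior), strict concavity makes the stationary branch the unique optimal solution of the Bellman problem, with $$V_T^S(x)=\tfrac12x^\top\mathscr P_T(S)x,\qquad \mathsf K_T^S(x)=K_T(S)x$$ for a symmetric matrix $\mathscr P_T(S)$ and a matrix $K_T(S)$. Let $V_s=\binom{X_s}{P_s}$, $V_u=\binom{X_u}{P_u}$, $D_s$, $D_u$ be as in the context and fix $K\ge1$, $\gamma>0$ such that for every $k\ge0$, $\|V_sD_s^k\|\le Ke^{-\gamma k}$ and $\|V_uD_u^{-k}\|\le Ke^{-\gamma k}$. Put $$C_s=P_s-SX_s,\qquad C_u=P_u-SX_u,\qquad E_T^{\rm Ric}=D_u^{-T}C_u^{-1}C_sD_s^T$$ ($D_u^{-T},D_s^T$ are powers). Then $$\mathscr P_T(S)=(P_s-P_uE_T^{\rm Ric})(X_s-X_uE_T^{\rm Ric})^{-1},$$ $$K_T(S)=R^{-1}B^\top A^{-\top}(\mathscr P_T(S)+Q).$$ For $\mathscr P_\infty=P_sX_s^{-1}$ and $K_\infty=R^{-1}B^\top A^{-\top}(\mathscr P_\infty+Q)$, there is a constant $C$ independent of $T$ with $$\|\mathscr P_T(S)-\mathscr P_\infty\|+\|K_T(S)-K_\infty\|\le Ce^{-2\gamma T}.$$ Uniformly for $S,\widetilde S$ in compact subsets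 of $\{S=S^\top\preceq0\}$, $$\|\mathscr P_T(S)-\mathscr P_T(\widetilde S)\|+\|K_T(S)-K_T(\widetilde S)\|\le Ce^{-2\gamma T}\|S-\widetilde S\| .$$ Thus, when two terminal rewards differ only through their Hessians, the induced Riccati matrices and initial gains differ by $O(e^{-2\gamma T})$.
   Context: The linear-quadratic problem with horizon $T\ge1$ is to maximize $\tfrac12x_T^\top Sx_T-\sum_{t=0}^{T-1}\bigl(\tfrac12x_t^\top Qx_t+\tfrac12u_t^\top Ru_t\bigr)$ subject to $x_{t+1}=Ax_t+Bu_t$, $x_0=x\in\mathbb R^d$, $u_t\in\mathbb R^m$; $V_T^S(x)$ is its optimal value and $\mathsf K_T^S(x)$ its optimal first control $u_0$. $(A,B)$ is stabilizable if $\operatorname{rank}[A-\mu I\ \ B]=d$ for every complex $\mu$ with $|\mu|\ge1$. The stationary branch is the solution of the Pontryagin equations $u_t=R^{-1}B^\top p_{t+1}$, $x_{t+1}=Ax_t+BR^{-1}B^\top p_{t+1}$, $p_t=A^\top p_{t+1}-Qx_t$ $(0\le t<T)$, $x_0=x$, $p_T=Sx_T$. With $G=BR^{-1}B^\top$, the one-step map of $(x_t,p_t)$ is $$M=\begin{pmatrix} A+GA^{-\top}Q & GA^{-\top} \\ A^{-\top}Q & A^{-\top} \end{pmatrix},$$ which under these hypotheses is symplectic and hyperbolic; the columns of $V_s,V_u\in\mathbb R^{2d\times d}$ are bases of its stable and unstable subspaces (eigenvalues of modulus $<1$, $>1$), $MV_s=V_sD_s$, $MV_u=V_uD_u$, with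 $d\times d$ blocks $X_s,P_s,X_u,P_u$; $X_s$ and $P_u-SX_u$ are invertible. *)

theory Defs
  imports "HOL-Analysis.Analysis" "HOL-Library.Landau_Symbols"
begin

abbreviation opnorm :: "real^'n^'m \<Rightarrow> real"
  where "opnorm A \<equiv> onorm ((*v) A)"

text \<open>The power operator of the library acts entrywise on matrices, hence a separate
  definition of powers for the matrix product.\<close>

primrec mat_power :: "'a::comm_ring_1^'n^'n \<Rightarrow> nat \<Rightarrow> 'a^'n^'n"
  where
    "mat_power A 0 = mat 1"
  | "mat_power A (Suc k) = A ** mat_power A k"

definition symmetric_posdef :: "real^'n^'n \<Rightarrow> bool"
  where "symmetric_posdef A \<longleftrightarrow> transpose A = A \<and> (\<forall>x. x \<noteq> 0 \<longrightarrow> x \<bullet> (A *v x) > 0)"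

definition symmetric_negsemidef :: "real^'n^'n \<Rightarrow> bool"
  where "symmetric_negsemidef A \<longleftrightarrow> transpose A = A \<and> (\<forall>x. x \<bullet> (A *v x) \<le> 0)"

text \<open>Block matrices are indexed by sum types, so that a \<open>2d\<close>-dimensional space is
  \<open>real^('d + 'd)\<close>.\<close>

definition hcat :: "'a^'n^'k \<Rightarrow> 'a^'m^'k \<Rightarrow> 'a^('n + 'm)^'k"
  where "hcat A B = (\<chi> i j. case j of Inl a \<Rightarrow> A $ i $ a | Inr b \<Rightarrow> B $ i $ b)"

definition vcat :: "'a^'k^'n \<Rightarrow> 'a^'k^'m \<Rightarrow> 'a^'k^('n + 'm)"
  where "vcat A B = (\<chi> i j. case i of Inl a \<Rightarrow> A $ a $ j | Inr b \<Rightarrow> B $ b $ j)"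

definition stabilizable :: "real^'d^'d \<Rightarrow> real^'m^'d \<Rightarrow> bool"
  where "stabilizable A B \<longleftrightarrow>
    (\<forall>\<mu>::complex. cmod \<mu> \<ge> 1 \<longrightarrow>
      rank (hcat (map_matrix complex_of_real A - mat \<mu>) (map_matrix complex_of_real B))
        = CARD('d))"

text \<open>The real vectors in the sum of the complex generalized eigenspaces of \<open>M\<close> for the
  eigenvalues in \<open>\<Lambda>\<close>.\<close>

definition spectral_subspace :: "real^'n^'n \<Rightarrow> complex set \<Rightarrow> (real^'n) set"
  where "spectral_subspace M \<Lambda> =
    {v. (\<chi> i. complex_of_real (v $ i)) \<in>
        vec.span (\<Union>\<mu>\<in>\<Lambda>. {w. \<exists>k. mat_power (map_matrix complex_of_real M - mat \<mu>) k *v w = 0})}"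

definition stable_subspace :: "real^'n^'n \<Rightarrow> (real^'n) set"
  where "stable_subspace M = spectral_subspace M {\<mu>. cmod \<mu> < 1}"

definition unstable_subspace :: "real^'n^'n \<Rightarrow> (real^'n) set"
  where "unstable_subspace M = spectral_subspace M {\<mu>. cmod \<mu> > 1}"

definition columns_basis_of :: "real^'k^'n \<Rightarrow> (real^'n) set \<Rightarrow> bool"
  where "columns_basis_of V W \<longleftrightarrow>
    inj (\<lambda>j. column j V) \<and> independent (columns V) \<and> span (columns V) = W"

text \<open>A control of horizon \<open>T\<close> is extensional on \<open>{..<T}\<close>, so that equality of controls means
  equality at the times \<open>t < T\<close>.  The parameter \<open>U\<close> is the set of admissible control values;
  the unconstrained problem has \<open>U = UNIV\<close>.\<close>

definition lq_controls :: "(real^'m) set \<Rightarrow> nat \<Rightarrow> (nat \<Rightarrow> real^'m) set"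
  where "lq_controls U T = ({..<T} \<rightarrow>\<^sub>E U)"

primrec lq_state ::
  "real^'d^'d \<Rightarrow> real^'m^'d \<Rightarrow> real^'d \<Rightarrow> (nat \<Rightarrow> real^'m) \<Rightarrow> nat \<Rightarrow> real^'d"
  where
    "lq_state A B x u 0 = x"
  | "lq_state A B x u (Suc t) = A *v lq_state A B x u t + B *v u t"

definition lq_reward ::
  "real^'d^'d \<Rightarrow> real^'m^'d \<Rightarrow> real^'d^'d \<Rightarrow> real^'m^'m \<Rightarrow> real^'d^'d \<Rightarrow>
    nat \<Rightarrow> real^'d \<Rightarrow> (nat \<Rightarrow> real^'m) \<Rightarrow> real"
  where "lq_reward A B Q R S T x u =
    1/2 * (lq_state A B x u T \<bullet> (S *v lq_state A B x u T))
    - (\<Sum>t<T. 1/2 * (lq_state A B x u t \<bullet> (Q *v lq_state A B x u t))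
             + 1/2 * (u t \<bullet> (R *v u t)))"

definition lq_optimal ::
  "real^'d^'d \<Rightarrow> real^'m^'d \<Rightarrow> real^'d^'d \<Rightarrow> real^'m^'m \<Rightarrow> real^'d^'d \<Rightarrow>
    (real^'m) set \<Rightarrow> nat \<Rightarrow> real^'d \<Rightarrow> (nat \<Rightarrow> real^'m) \<Rightarrow> bool"
  where "lq_optimal A B Q R S U T x u \<longleftrightarrow>
    is_arg_max (lq_reward A B Q R S T x) (\<lambda>w. w \<in> lq_controls U T) u"

definition lq_value ::
  "real^'d^'d \<Rightarrow> real^'m^'d \<Rightarrow> real^'d^'d \<Rightarrow> real^'m^'m \<Rightarrow> real^'d^'d \<Rightarrow>
    (real^'m) set \<Rightarrow> nat \<Rightarrow> real^'d \<Rightarrow> real"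
  where "lq_value A B Q R S U T x = (SUP u\<in>lq_controls U T. lq_reward A B Q R S T x u)"

definition lq_first_control ::
  "real^'d^'d \<Rightarrow> real^'m^'d \<Rightarrow> real^'d^'d \<Rightarrow> real^'m^'m \<Rightarrow> real^'d^'d \<Rightarrow>
    (real^'m) set \<Rightarrow> nat \<Rightarrow> real^'d \<Rightarrow> real^'m"
  where "lq_first_control A B Q R S U T x = (THE u. lq_optimal A B Q R S U T x u) 0"

text \<open>\<open>u\<close>, \<open>\<xi>\<close>, \<open>p\<close> are the controls, states and costates of the stationary branch.\<close>

definition stationary_branch ::
  "real^'d^'d \<Rightarrow> real^'m^'d \<Rightarrow> real^'d^'d \<Rightarrow> real^'m^'m \<Rightarrow> real^'d^'d \<Rightarrow>
    nat \<Rightarrow> real^'d \<Rightarrow> (nat \<Rightarrow> real^'m) \<times> (nat \<Rightarrow> real^'d) \<times> (nat \<Rightarrow> real^'d) \<Rightarrow> bool"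
  where "stationary_branch A B Q R S T x = (\<lambda>(u, \<xi>, p).
    u \<in> ({..<T} \<rightarrow>\<^sub>E UNIV) \<and> \<xi> \<in> ({..T} \<rightarrow>\<^sub>E UNIV) \<and> p \<in> ({..T} \<rightarrow>\<^sub>E UNIV) \<and>
    \<xi> 0 = x \<and> p T = S *v \<xi> T \<and>
    (\<forall>t<T. u t = (matrix_inv R ** transpose B) *v p (Suc t) \<and>
           \<xi> (Suc t) = A *v \<xi> t + (B ** matrix_inv R ** transpose B) *v p (Suc t) \<and>
           p t = transpose A *v p (Suc t) - Q *v \<xi> t))"

definition hamiltonian_step ::
  "real^'d^'d \<Rightarrow> real^'m^'d \<Rightarrow> real^'d^'d \<Rightarrow> real^'m^'m \<Rightarrow> real^('d + 'd)^('d + 'd)"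
  where "hamiltonian_step A B Q R =
    (let G = B ** matrix_inv R ** transpose B; N = matrix_inv (transpose A)
     in vcat (hcat (A + G ** N ** Q) (G ** N)) (hcat (N ** Q) N))"

definition ric_error ::
  "real^'d^'d \<Rightarrow> real^'d^'d \<Rightarrow> real^'d^'d \<Rightarrow> real^'d^'d \<Rightarrow> real^'d^'d \<Rightarrow> real^'d^'d \<Rightarrow>
    real^'d^'d \<Rightarrow> nat \<Rightarrow> real^'d^'d"
  where "ric_error Xs Ps Xu Pu Ds Du S T =
    mat_power (matrix_inv Du) T ** matrix_inv (Pu - S ** Xu) ** (Ps - S ** Xs) ** mat_power Ds T"

definition lq_gain ::
  "real^'d^'d \<Rightarrow> real^'m^'d \<Rightarrow> real^'d^'d \<Rightarrow> real^'m^'m \<Rightarrow> real^'d^'d \<Rightarrow> real^'d^'m"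
  where "lq_gain A B Q R P = matrix_inv R ** transpose B ** matrix_inv (transpose A) ** (P + Q)"

end

theory Submission
  imports Defs "HOL-Computational_Algebra.Fundamental_Theorem_Algebra"
begin

text \<open>
  Along every solution of the Hamiltonian system the energy \<open>p\<^sub>t \<bullet> x\<^sub>t\<close> increases by
  \<open>x\<^sub>t \<bullet> Q x\<^sub>t + p\<^sub>t\<^sub>+\<^sub>1 \<bullet> G p\<^sub>t\<^sub>+\<^sub>1 \<ge> 0\<close>, while the symplectic form \<open>p\<^sub>t \<bullet> y\<^sub>t - q\<^sub>t \<bullet> x\<^sub>t\<close> of two
  solutions is constant.  A solution \<open>V\<^sub>s D\<^sub>s\<^sup>t a + V\<^sub>u D\<^sub>u\<^sup>-\<^sup>(\<^sup>T\<^sup>-\<^sup>t\<^sup>) b\<close> whose energy cannot increase is rigid;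
  this gives the invertibility of \<open>X\<^sub>s\<close> (with stabilizability), of \<open>P\<^sub>u - S X\<^sub>u\<close> and of
  \<open>X\<^sub>s - X\<^sub>u E\<^sub>T\<close>, and the uniqueness of the stationary branch.

  Let \<open>\<Phi>\<^sub>T(S)\<close> map \<open>x\<^sub>0\<close> to \<open>x\<^sub>T\<close> along the branch.  The symplectic form at both ends yields
  \<open>P\<^sub>T(S) - P\<^sub>T(S') = \<Phi>\<^sub>T(S)\<^sup>T (S - S') \<Phi>\<^sub>T(S')\<close>, and \<open>\<Phi>\<^sub>T\<close> contains the factor \<open>D\<^sub>s\<^sup>T\<close>, hence the
  rate \<open>e\<^sup>-\<^sup>2\<^sup>\<gamma>\<^sup>T\<close>.  Convergence is the special case \<open>S' = P\<^sub>\<infinity>\<close>, because \<open>P\<^sub>\<infinity>\<close> is symmetric negative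
  semidefinite and \<open>P\<^sub>T(P\<^sub>\<infinity>) = P\<^sub>\<infinity>\<close>.
\<close>

section \<open>Decaying costates and stabilizability\<close>

text \<open>As a simp rule it would turn \<open>transpose A *v x\<close> into a row-vector product;
  the adjoint calculations below use the matrix form.\<close>

declare transpose_matrix_vector [simp del]

lemma matrix_inv_left: "invertible A \<Longrightarrow> matrix_inv A ** A = mat 1"
  and matrix_inv_right: "invertible A \<Longrightarrow> A ** matrix_inv A = mat 1"
  unfolding matrix_inv_def invertible_def by (metis (mono_tags, lifting) someI_ex)+

text \<open>Rows that span a space of dimension \<open>CARD('k)\<close> are distinct and
  independent, so only the trivial combination of them is zero. This converts the rank condition of
  stabilizability into the absence of left null vectors.\<close>

lemma full_row_rank_left_kernel:
  fixes M :: "'a::field^'n^'k"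
  assumes rk: "rank M = CARD('k)" and z: "\<And>j. (\<Sum>i\<in>UNIV. c $ i * M $ i $ j) = 0"
  shows "c = 0"
proof -
  have rows: "rows M = range (\<lambda>i. row i M)" by (auto simp: rows_def)
  have fin: "finite (rows M)" by (simp add: rows)
  have d: "vec.dim (rows M) = CARD('k)" using rk by (simp add: row_rank_def_gen)
  have "vec.dim (rows M) \<le> card (rows M)" by (rule vec.dim_le_card'[OF fin])
  moreover have "card (rows M) \<le> CARD('k)" unfolding rows by (rule card_image_le) simp
  ultimately have card: "card (rows M) = CARD('k)" using d by simp
  have inj: "inj (\<lambda>i. row i M)"
    by (rule eq_card_imp_inj_on) (use card rows in auto)
  have ind: "vec.independent (rows M)"
    by (rule vec.card_le_dim_spanning[of _ "rows M"]) (auto simp: vec.span_base fin d card)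
  define f where "f v = c $ (inv (\<lambda>i. row i M) v)" for v
  have "(\<Sum>v\<in>rows M. f v *s v) = (\<Sum>i\<in>UNIV. c $ i *s row i M)"
    unfolding rows by (subst sum.reindex[OF inj]) (simp add: f_def inv_f_f[OF inj])
  also have "\<dots> = 0"
    using z by (simp add: vec_eq_iff row_def)
  finally have "f v = 0" if "v \<in> rows M" for v
    using vec.independentD[OF ind fin order_refl _ that] by blast
  then have "c $ i = 0" for i
    using inv_f_f[OF inj, of i] by (metis f_def rangeI rows)
  then show ?thesis by (simp add: vec_eq_iff)
qed

text \<open>The vectors \<open>w 0\<close>, ..., \<open>w d\<close> outnumber the dimension
  \<open>d\<close>. Their dependence is stored as a polynomial so that it can be factored
  later.\<close>

lemma sequence_linear_relation:
  fixes w :: "nat \<Rightarrow> 'a::field^'n"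
  obtains q :: "'a poly" where "q \<noteq> 0" "(\<Sum>k\<le>degree q. coeff q k *s w k) = 0"
proof -
  define d where "d = CARD('n)"
  have "\<exists>c. (\<exists>k\<le>d. c k \<noteq> 0) \<and> (\<Sum>k\<le>d. c k *s w k) = 0"
  proof (cases "inj_on w {..d}")
    case True
    have "card (w ` {..d}) > vec.dim (w ` {..d})"
      using card_image[OF True] vec.dim_subset[of "w ` {..d}" UNIV]
      by (simp add: d_def vec_dim_card card_cart_basis)
    then have "vec.dependent (w ` {..d})"
      using vec.dim_eq_card_independent by fastforce
    then obtain u v where u: "v \<in> w ` {..d}" "u v \<noteq> 0" "(\<Sum>v\<in>w ` {..d}. u v *s v) = 0"
      using vec.dependent_finite[of "w ` {..d}"] by auto
    then have "(\<Sum>k\<le>d. (u \<circ> w) k *s w k) = 0"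
      by (simp add: sum.reindex[OF True])
    moreover have "\<exists>k\<le>d. (u \<circ> w) k \<noteq> 0" using u by auto
    ultimately show ?thesis by blast
  next
    case False
    then obtain i j where ij: "i \<le> d" "j \<le> d" "i \<noteq> j" "w i = w j"
      by (auto simp: inj_on_def)
    \<comment> \<open>A repeated term is a relation in itself, which linear dependence of the set of
      values would not detect.\<close>
    define c where "c k = (if k = i then 1 else 0) - (if k = j then 1 else (0::'a))" for k
    have "(\<Sum>k\<le>d. c k *s w k) =
        (\<Sum>k\<le>d. if k = i then w k else 0) - (\<Sum>k\<le>d. if k = j then w k else 0)"
      unfolding sum_subtractf[symmetric] by (rule sum.cong) (auto simp: c_def)
    also have "\<dots> = 0" using ij by (simp add: sum.delta)
    finally show ?thesis using ij by (intro exI[of _ c]) (auto simp: c_def)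
  qed
  then obtain c k where c: "k \<le> d" "c k \<noteq> 0" "(\<Sum>k\<le>d. c k *s w k) = 0" by blast
  define q where "q = Poly (map c [0..<Suc d])"
  have cq: "coeff q j = (if j \<le> d then c j else 0)" for j
    by (auto simp: q_def nth_default_def simp del: upt_Suc)
  have "degree q \<le> d" by (rule degree_le) (simp add: cq)
  then have "(\<Sum>k\<le>degree q. coeff q k *s w k) = (\<Sum>k\<le>d. coeff q k *s w k)"
    by (intro sum.mono_neutral_left) (auto simp: coeff_eq_0)
  also have "\<dots> = 0" using c(3) by (simp add: cq)
  finally show thesis using that[of q] c cq[of k] by fastforce
qed

text \<open>Dividing a relation of minimal degree by one of its linear factors leaves an eigenvector.\<close>

lemma orbit_span_eigenvector:
  fixes w :: "nat \<Rightarrow> complex^'n"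
  assumes w: "\<And>k. w (Suc k) = N *v w k" and w0: "w 0 \<noteq> 0"
  obtains n c \<mu> where "(\<Sum>k\<le>n. c k *s w k) \<noteq> 0"
    "(\<Sum>k\<le>n. c k *s w (Suc k)) = \<mu> *s (\<Sum>k\<le>n. c k *s w k)"
proof -
  define L where "L q = (\<Sum>k\<le>degree q. coeff q k *s w k)" for q
  define P where "P q \<longleftrightarrow> q \<noteq> 0 \<and> L q = 0" for q
  obtain q0 where "P q0" using sequence_linear_relation[of w] unfolding P_def L_def by metis
  then obtain q where q: "P q" and min: "\<And>r. P r \<Longrightarrow> degree q \<le> degree r"
    using ex_has_least_nat[of P q0 degree] by blast
  have "degree q \<noteq> 0"
  proof
    assume "degree q = 0"
    then obtain a where "q = [:a:]" by (meson degree_eq_zeroE)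
    with q w0 show False by (auto simp: P_def L_def)
  qed
  then have "\<not> constant (poly q)" by (simp add: constant_degree)
  then obtain \<mu> where "poly q \<mu> = 0" using fundamental_theorem_of_algebra by blast
  then obtain r where r: "q = [:-\<mu>, 1:] * r" unfolding poly_eq_0_iff_dvd by (auto elim: dvdE)
  with q have "r \<noteq> 0" by (auto simp: P_def)
  have deg: "degree q = Suc (degree r)" unfolding r using \<open>r \<noteq> 0\<close> by (subst degree_mult_eq) auto
  \<comment> \<open>Minimality of the degree of \<open>q\<close>: the quotient \<open>r\<close>
    cannot be a relation.\<close>
  have nz: "L r \<noteq> 0" using min[of r] deg \<open>r \<noteq> 0\<close> by (auto simp: P_def)
  have cq: "coeff q k = (case k of 0 \<Rightarrow> 0 | Suc j \<Rightarrow> coeff r j) - \<mu> * coeff r k" for k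
    by (cases k) (simp_all add: r)
  \<comment> \<open>Multiplication by the variable shifts the sequence, so \<open>L q = 0\<close>
    says that the shifted combination for \<open>r\<close> is \<open>\<mu>\<close> times the
    unshifted one.\<close>
  have "0 = L q" using q by (simp add: P_def)
  also have "\<dots> = (\<Sum>k\<le>Suc (degree r). (case k of 0 \<Rightarrow> 0 | Suc j \<Rightarrow> coeff r j) *s w k)
      - \<mu> *s (\<Sum>k\<le>Suc (degree r). coeff r k *s w k)"
    unfolding L_def deg cq
    by (simp add: vector_sub_rdistrib sum_subtractf vec.scale_sum_right vec.scale_left_diff_distrib)
  also have "(\<Sum>k\<le>Suc (degree r). (case k of 0 \<Rightarrow> 0 | Suc j \<Rightarrow> coeff r j) *s w k)
      = (\<Sum>k\<le>degree r. coeff r k *s w (Suc k))"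
    by (subst sum.atMost_Suc_shift) simp
  also have "(\<Sum>k\<le>Suc (degree r). coeff r k *s w k) = L r"
    by (simp add: L_def coeff_eq_0)
  finally show thesis using that[of "coeff r" "degree r" \<mu>] nz by (simp add: L_def)
qed

lemma map_matrix_of_real_vector_mult:
  fixes A :: "real^'n^'k"
  shows "map_matrix complex_of_real A *v (\<chi> i. complex_of_real (x $ i))
    = (\<chi> i. complex_of_real ((A *v x) $ i))"
  by (simp add: matrix_vector_mult_def vec_eq_iff)

text \<open>The Hautus test, in the dual form in which it excludes unobservable decaying costates.\<close>

lemma stabilizable_decaying_costate_zero:
  fixes A :: "real^'d^'d" and B :: "real^'m^'d" and p :: "nat \<Rightarrow> real^'d"
  assumes st: "stabilizable A B" and inv: "invertible A"
    and p: "\<And>t. p t = transpose A *v p (Suc t)" and pB: "\<And>t. transpose B *v p t = 0"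
    and lim: "p \<longlonglongrightarrow> 0"
  shows "p 0 = 0"
proof (rule ccontr)
  assume p0: "p 0 \<noteq> 0"
  define w where "w k = (\<chi> i. complex_of_real (p k $ i))" for k
  define N where "N = map_matrix complex_of_real (matrix_inv (transpose A))"
  have "matrix_inv (transpose A) *v p t = p (Suc t)" for t
    unfolding p[of t] matrix_vector_mul_assoc
    by (simp add: matrix_inv_left transpose_invertible inv)
  then have wN: "w (Suc k) = N *v w k" for k
    by (simp add: w_def N_def map_matrix_of_real_vector_mult)
  have w0: "w 0 \<noteq> 0" using p0 by (simp add: w_def vec_eq_iff)
  obtain n c \<nu> where nz: "(\<Sum>k\<le>n. c k *s w k) \<noteq> 0"
    and eig: "(\<Sum>k\<le>n. c k *s w (Suc k)) = \<nu> *s (\<Sum>k\<le>n. c k *s w k)"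
    by (rule orbit_span_eigenvector[OF wN w0])
  \<comment> \<open>The eigenvector shifted \<open>j\<close> steps along the orbit. As a fixed
    combination of costates it tends to 0, while it equals \<open>\<nu> ^ j\<close> times
    \<open>v 0\<close>; hence \<open>\<nu>\<close> has modulus below 1.\<close>
  define v where "v j = (\<Sum>k\<le>n. c k *s w (k + j))" for j
  have vN: "v (Suc j) = N *v v j" for j
    by (simp add: v_def wN vec.linear_sum[OF matrix_vector_mul_linear_gen] vec.linear_scale[OF matrix_vector_mul_linear_gen])
  have v_pow: "v j = \<nu> ^ j *s v 0" for j
  proof (induction j)
    case (Suc j)
    have "v (Suc j) = \<nu> ^ j *s (N *v v 0)"
      unfolding vN Suc.IH by (simp add: vec.linear_scale[OF matrix_vector_mul_linear_gen])
    also have "N *v v 0 = \<nu> *s v 0" using eig vN[of 0] by (simp add: v_def)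
    finally show ?case by (simp add: vector_smult_assoc mult.commute)
  qed (simp add: v_def)
  have v0: "v 0 \<noteq> 0" using nz by (simp add: v_def)
  then obtain i where i: "v 0 $ i \<noteq> 0" by (auto simp: vec_eq_iff)
  have wlim: "(\<lambda>j. w j $ i) \<longlonglongrightarrow> 0"
    using tendsto_of_real[OF tendsto_vec_nth[OF lim, of i], where 'a=complex] by (simp add: w_def)
  have "(\<lambda>j. v j $ i) \<longlonglongrightarrow> (\<Sum>k\<le>n. c k * 0)"
    unfolding v_def sum_component vector_smult_component
    by (intro tendsto_sum tendsto_mult tendsto_const)
      (use LIMSEQ_ignore_initial_segment[OF wlim] in \<open>simp add: add.commute\<close>)
  then have "(\<lambda>j. \<nu> ^ j * v 0 $ i) \<longlonglongrightarrow> 0"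
    by (subst (asm) v_pow) simp
  then have "(\<lambda>j. \<nu> ^ j * v 0 $ i * inverse (v 0 $ i)) \<longlonglongrightarrow> 0 * inverse (v 0 $ i)"
    by (intro tendsto_mult tendsto_const)
  then have "(\<lambda>j. \<nu> ^ j) \<longlonglongrightarrow> 0" using i by (simp add: mult.assoc)
  then have "(\<lambda>j. cmod (\<nu> ^ j)) \<longlonglongrightarrow> 0" by (rule tendsto_norm_zero)
  then obtain j where "cmod (\<nu> ^ j) < 1"
    using eventually_happens'[OF sequentially_bot order_tendstoD(2)[OF _ zero_less_one]] by blast
  then have small: "cmod \<nu> < 1"
    by (metis norm_power not_less one_le_power)
  have At: "map_matrix complex_of_real (transpose A) *v v (Suc j) = v j" for j
  proof -
    have "map_matrix complex_of_real (transpose A) *v w (Suc k) = w k" for k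
      using p[of k] by (simp add: w_def map_matrix_of_real_vector_mult)
    then show ?thesis
      by (simp add: v_def vec.linear_sum[OF matrix_vector_mul_linear_gen] vec.linear_scale[OF matrix_vector_mul_linear_gen])
  qed
  have l0: "\<nu> \<noteq> 0" using At[of 0] v_pow[of 1] v0 by auto
  \<comment> \<open>Passing from the inverse of \<open>transpose A\<close> back to
    \<open>transpose A\<close> inverts the eigenvalue: \<open>v 0\<close> belongs to
    \<open>\<mu>\<close>, of modulus at least 1, and lies in the kernel of the transposed
    \<open>B\<close>. The rank condition at \<open>\<mu>\<close> excludes this.\<close>
  define \<mu> where "\<mu> = inverse \<nu>"
  have "cmod \<mu> \<ge> 1" using small l0 by (simp add: \<mu>_def norm_inverse one_le_inverse)
  have Av: "map_matrix complex_of_real (transpose A) *v v 0 = \<mu> *s v 0"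
  proof -
    have "\<nu> *s (map_matrix complex_of_real (transpose A) *v v 0) = v 0"
      using At[of 0] v_pow[of 1] by (simp add: vec.linear_scale[OF matrix_vector_mul_linear_gen])
    then have "\<mu> *s v 0 = (\<mu> * \<nu>) *s (map_matrix complex_of_real (transpose A) *v v 0)"
      by (metis vector_smult_assoc)
    then show ?thesis using l0 by (simp add: \<mu>_def)
  qed
  have "map_matrix complex_of_real (transpose B) *v w k = 0" for k
    using pB[of k] by (simp add: w_def map_matrix_of_real_vector_mult vec_eq_iff)
  then have Bv: "map_matrix complex_of_real (transpose B) *v v 0 = 0"
    by (simp add: v_def vec.linear_sum[OF matrix_vector_mul_linear_gen] vec.linear_scale[OF matrix_vector_mul_linear_gen])
  let ?H = "hcat (map_matrix complex_of_real A - mat \<mu>) (map_matrix complex_of_real B)"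
  have "v 0 = 0"
  proof (rule full_row_rank_left_kernel)
    show "rank ?H = CARD('d)" using st \<open>cmod \<mu> \<ge> 1\<close> by (simp add: stabilizable_def)
    fix j
    show "(\<Sum>i\<in>UNIV. v 0 $ i * ?H $ i $ j) = 0"
    proof (cases j)
      case (Inl a)
      have "(\<Sum>i\<in>UNIV. v 0 $ i * ?H $ i $ j)
          = (\<Sum>i\<in>UNIV. complex_of_real (A $ i $ a) * v 0 $ i) - (\<Sum>i\<in>UNIV. if i = a then \<mu> * v 0 $ i else 0)"
        unfolding sum_subtractf[symmetric]
        by (rule sum.cong) (auto simp: Inl hcat_def mat_def algebra_simps)
      also have "\<dots> = (map_matrix complex_of_real (transpose A) *v v 0) $ a - \<mu> * v 0 $ a"
        by (simp add: matrix_vector_mult_def transpose_def)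
      finally show ?thesis by (simp add: Av)
    next
      case (Inr b)
      have "(\<Sum>i\<in>UNIV. v 0 $ i * ?H $ i $ j) = (map_matrix complex_of_real (transpose B) *v v 0) $ b"
        by (simp add: Inr hcat_def matrix_vector_mult_def transpose_def mult.commute)
      then show ?thesis by (simp add: Bv)
    qed
  qed
  then show False using v0 by simp
qed

section \<open>The Hamiltonian system and optimality\<close>

lemma inner_transpose_left: "(transpose A *v x) \<bullet> y = x \<bullet> (A *v y)"
  for A :: "real^'n^'k"
  by (simp add: transpose_matrix_vector dot_lmul_matrix)

lemma symmetric_inner_commute:
  fixes A :: "real^'n^'n"
  assumes "transpose A = A"
  shows "x \<bullet> (A *v y) = y \<bullet> (A *v x)"
  using inner_transpose_left[of A y x] assms by (simp add: inner_commute)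

lemma invertible_if_kernel_zero:
  fixes A :: "real^'n^'n"
  assumes "\<And>x. A *v x = 0 \<Longrightarrow> x = 0"
  shows "invertible A"
  using assms by (simp add: invertible_left_inverse matrix_left_invertible_ker)

lemma symmetric_posdef_invertible: "symmetric_posdef A \<Longrightarrow> invertible A"
  by (rule invertible_if_kernel_zero) (force simp: symmetric_posdef_def)

lemma symmetric_posdef_matrix_inv:
  assumes A: "symmetric_posdef A"
  shows "symmetric_posdef (matrix_inv A)"
proof -
  have inv: "invertible A" by (rule symmetric_posdef_invertible[OF A])
  have sym: "transpose A = A" using A by (simp add: symmetric_posdef_def)
  let ?N = "matrix_inv A"
  have cancel: "A *v (?N *v x) = x" for x
    by (simp add: matrix_vector_mul_assoc matrix_inv_right[OF inv])
  have "transpose ?N = transpose ?N ** (A ** ?N)"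
    by (simp add: matrix_inv_right[OF inv])
  also have "\<dots> = transpose (A ** ?N) ** ?N"
    by (simp add: matrix_transpose_mul sym matrix_mul_assoc)
  finally have "transpose ?N = ?N" by (simp add: matrix_inv_right[OF inv] transpose_mat)
  moreover have "x \<bullet> (?N *v x) > 0" if "x \<noteq> 0" for x
  proof -
    have "?N *v x \<noteq> 0" using cancel[of x] that by auto
    then have "(?N *v x) \<bullet> (A *v (?N *v x)) > 0" using A by (simp add: symmetric_posdef_def)
    then show ?thesis by (simp add: cancel inner_commute)
  qed
  ultimately show ?thesis by (simp add: symmetric_posdef_def)
qed

lemma symmetric_posdef_quadratic:
  assumes "symmetric_posdef A"
  shows "0 \<le> x \<bullet> (A *v x)" and "x \<bullet> (A *v x) = 0 \<longleftrightarrow> x = 0"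
  using assms by (cases "x = 0"; force simp: symmetric_posdef_def)+

section \<open>Hamiltonian orbits, their energy and the symplectic form\<close>

locale lq_problem =
  fixes A Q :: "real^'d^'d" and B :: "real^'m^'d" and R :: "real^'m^'m"
  assumes A: "invertible A" and Q: "symmetric_posdef Q" and R: "symmetric_posdef R"
begin

definition G :: "real^'d^'d" where "G = B ** matrix_inv R ** transpose B"

text \<open>The Pontryagin equations with the control eliminated and without boundary conditions, in
  the implicit form that avoids the inverse of \<open>A\<close>.\<close>

definition hamiltonian_orbit :: "nat \<Rightarrow> (nat \<Rightarrow> real^'d) \<Rightarrow> (nat \<Rightarrow> real^'d) \<Rightarrow> bool"
  where "hamiltonian_orbit T x p \<longleftrightarrow>
    (\<forall>t<T. x (Suc t) = A *v x t + G *v p (Suc t) \<and> p t = transpose A *v p (Suc t) - Q *v x t)"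

lemma inner_G: "p \<bullet> (G *v q) = (transpose B *v p) \<bullet> (matrix_inv R *v (transpose B *v q))"
  by (simp add: G_def inner_transpose_left matrix_vector_mul_assoc[symmetric])

lemma inner_G_commute: "p \<bullet> (G *v q) = q \<bullet> (G *v p)"
  unfolding inner_G by (rule symmetric_inner_commute)
    (use symmetric_posdef_matrix_inv[OF R] in \<open>simp add: symmetric_posdef_def\<close>)

lemma inner_Q_commute: "x \<bullet> (Q *v y) = y \<bullet> (Q *v x)"
  by (rule symmetric_inner_commute) (use Q in \<open>simp add: symmetric_posdef_def\<close>)

lemma inner_R_commute: "x \<bullet> (R *v y) = y \<bullet> (R *v x)"
  by (rule symmetric_inner_commute) (use R in \<open>simp add: symmetric_posdef_def\<close>)

lemma inner_G_nonneg: "0 \<le> p \<bullet> (G *v p)"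
  unfolding inner_G by (rule symmetric_posdef_quadratic[OF symmetric_posdef_matrix_inv[OF R]])

lemma inner_G_eq_0_iff: "p \<bullet> (G *v p) = 0 \<longleftrightarrow> transpose B *v p = 0"
  unfolding inner_G by (rule symmetric_posdef_quadratic[OF symmetric_posdef_matrix_inv[OF R]])

lemma G_eq_0: "transpose B *v p = 0 \<Longrightarrow> G *v p = 0"
  by (simp add: G_def matrix_vector_mul_assoc[symmetric])

lemmas inner_Q_nonneg = symmetric_posdef_quadratic(1)[OF Q]
lemmas inner_Q_eq_0_iff = symmetric_posdef_quadratic(2)[OF Q]
lemmas inner_R_nonneg = symmetric_posdef_quadratic(1)[OF R]
lemmas inner_R_eq_0_iff = symmetric_posdef_quadratic(2)[OF R]

lemma R_matrix_inv: "R *v (matrix_inv R *v u) = u"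
  by (simp add: matrix_vector_mul_assoc matrix_inv_right[OF symmetric_posdef_invertible[OF R]])

lemma orbit_stepD:
  assumes "hamiltonian_orbit T x p" "t < T"
  shows "x (Suc t) = A *v x t + G *v p (Suc t)" and "transpose A *v p (Suc t) = p t + Q *v x t"
  using assms by (auto simp: hamiltonian_orbit_def)

text \<open>Once \<open>A\<close> is moved onto the costate, the costate equation produces the
  \<open>Q\<close> term and the state equation the \<open>G\<close> term. The summand is symmetric
  in the two orbits, which makes the symplectic form constant; for equal orbits it is nonnegative,
  which makes the energy nondecreasing.\<close>

lemma pairing_sum:
  assumes x: "hamiltonian_orbit T x p" and y: "hamiltonian_orbit T y q" and "n \<le> T"
  shows "p n \<bullet> y n = p 0 \<bullet> y 0
    + (\<Sum>t<n. x t \<bullet> (Q *v y t) + p (Suc t) \<bullet> (G *v q (Suc t)))"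
  using \<open>n \<le> T\<close>
proof (induction n)
  case (Suc n)
  then have n: "n < T" by simp
  have "p (Suc n) \<bullet> y (Suc n) = (transpose A *v p (Suc n)) \<bullet> y n + p (Suc n) \<bullet> (G *v q (Suc n))"
    by (simp add: orbit_stepD(1)[OF y n] inner_add_right inner_transpose_left)
  also have "(transpose A *v p (Suc n)) \<bullet> y n = p n \<bullet> y n + x n \<bullet> (Q *v y n)"
    by (simp add: orbit_stepD(2)[OF x n] inner_add_left inner_Q_commute[of "x n" "y n"])
      (rule inner_commute)
  finally show ?case using Suc by simp
qed simp

lemma symplectic:
  assumes x: "hamiltonian_orbit T x p" and y: "hamiltonian_orbit T y q"
  shows "p T \<bullet> y T - q T \<bullet> x T = p 0 \<bullet> y 0 - q 0 \<bullet> x 0"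
  using pairing_sum[OF x y order_refl] pairing_sum[OF y x order_refl]
  by (simp add: inner_Q_commute[of "y _"] inner_G_commute[of "q _"])

lemma energy_ge:
  assumes x: "hamiltonian_orbit T x p" and t: "t < T"
  shows "p 0 \<bullet> x 0 + (x t \<bullet> (Q *v x t) + p (Suc t) \<bullet> (G *v p (Suc t))) \<le> p T \<bullet> x T"
proof -
  have "x t \<bullet> (Q *v x t) + p (Suc t) \<bullet> (G *v p (Suc t))
      \<le> (\<Sum>t<T. x t \<bullet> (Q *v x t) + p (Suc t) \<bullet> (G *v p (Suc t)))"
    using t by (intro member_le_sum) (auto simp: inner_Q_nonneg inner_G_nonneg)
  then show ?thesis using pairing_sum[OF x x order_refl] by simp
qed

lemma energy_mono:
  assumes x: "hamiltonian_orbit T x p"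
  shows "p 0 \<bullet> x 0 \<le> p T \<bullet> x T"
  unfolding pairing_sum[OF x x order_refl]
  by (simp add: inner_Q_nonneg inner_G_nonneg sum_nonneg)

text \<open>Each energy increment is nonnegative and at most the total growth, so it vanishes;
  definiteness of \<open>Q\<close> and of the inverse of \<open>R\<close> does the rest.\<close>

lemma energy_rigid:
  assumes x: "hamiltonian_orbit T x p" and t: "t < T" and le: "p T \<bullet> x T \<le> p 0 \<bullet> x 0"
  shows "x t = 0" and "transpose B *v p (Suc t) = 0"
proof -
  have "x t \<bullet> (Q *v x t) + p (Suc t) \<bullet> (G *v p (Suc t)) \<le> 0"
    using energy_ge[OF x t] le by simp
  then have "x t \<bullet> (Q *v x t) = 0" "p (Suc t) \<bullet> (G *v p (Suc t)) = 0"
    using inner_Q_nonneg[of "x t"] inner_G_nonneg[of "p (Suc t)"] by linarith+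
  then show "x t = 0" and "transpose B *v p (Suc t) = 0"
    by (simp_all add: inner_Q_eq_0_iff inner_G_eq_0_iff)
qed

text \<open>The energy starts at 0 and ends at a nonpositive value because \<open>S\<close> is
  negative semidefinite, so the orbit is rigid. The states vanish first, then the costates,
  backwards from the terminal condition.\<close>

lemma orbit_zero:
  assumes x: "hamiltonian_orbit T x p" and S: "symmetric_negsemidef S"
    and pT: "p T = S *v x T" and x0: "x 0 = 0" and t: "t \<le> T"
  shows "x t = 0 \<and> p t = 0"
proof -
  have le: "p T \<bullet> x T \<le> p 0 \<bullet> x 0"
    using S by (simp add: pT x0 symmetric_negsemidef_def inner_commute)
  have xz: "x s = 0" if "s \<le> T" for s
  proof (cases s)
    case (Suc r)
    then have "r < T" using that by simp
    then show ?thesis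
      using orbit_stepD(1)[OF x] energy_rigid[OF x _ le, of r] by (simp add: Suc G_eq_0)
  qed (simp add: x0)
  have "p t = 0" using t
  proof (induction t rule: inc_induct)
    case base
    then show ?case by (simp add: pT xz)
  next
    case (step n)
    then show ?case using orbit_stepD(2)[OF x, of n] xz[of n] by simp
  qed
  then show ?thesis using xz t by simp
qed

lemma orbit_diff:
  assumes "hamiltonian_orbit T x p" "hamiltonian_orbit T y q"
  shows "hamiltonian_orbit T (\<lambda>t. x t - y t) (\<lambda>t. p t - q t)"
  using assms unfolding hamiltonian_orbit_def
  by (simp add: matrix_vector_mult_diff_distrib)

lemma orbit_unique:
  assumes x: "hamiltonian_orbit T x p" and y: "hamiltonian_orbit T y q"
    and S: "symmetric_negsemidef S"
    and "p T = S *v x T" "q T = S *v y T" "x 0 = y 0" "t \<le> T"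
  shows "x t = y t \<and> p t = q t"
  using orbit_zero[OF orbit_diff[OF x y] S] assms(4-)
  by (simp add: matrix_vector_mult_diff_distrib)

section \<open>Reward deviations and optimality of the stationary branch\<close>

abbreviation feedback :: "(nat \<Rightarrow> real^'d) \<Rightarrow> nat \<Rightarrow> real^'m"
  where "feedback p t \<equiv> (matrix_inv R ** transpose B) *v p (Suc t)"

abbreviation reward :: "real^'d^'d \<Rightarrow> nat \<Rightarrow> real^'d \<Rightarrow> (nat \<Rightarrow> real^'m) \<Rightarrow> real"
  where "reward \<equiv> lq_reward A B Q R"

lemma B_feedback: "B *v feedback p t = G *v p (Suc t)"
  by (simp add: G_def matrix_vector_mul_assoc matrix_mul_assoc)

lemma R_feedback: "R *v feedback p t = transpose B *v p (Suc t)"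
  by (simp add: matrix_vector_mul_assoc[symmetric] R_matrix_inv)

lemma stationary_branch_iff:
  "stationary_branch A B Q R S T z (u, x, p) \<longleftrightarrow>
    u \<in> extensional {..<T} \<and> x \<in> extensional {..T} \<and> p \<in> extensional {..T} \<and>
    x 0 = z \<and> p T = S *v x T \<and> (\<forall>t<T. u t = feedback p t) \<and> hamiltonian_orbit T x p"
  by (auto simp: stationary_branch_def hamiltonian_orbit_def G_def PiE_def)

lemma state_deviation:
  assumes x: "hamiltonian_orbit T x p" and "t \<le> T"
  shows "lq_state A B (x 0) w t = x t + lq_state A B 0 (\<lambda>t. w t - feedback p t) t"
  using \<open>t \<le> T\<close>
proof (induction t)
  case (Suc t)
  then show ?case
    using orbit_stepD(1)[OF x, of t] B_feedback[of p t]
    by (simp add: matrix_vector_right_distrib matrix_vector_mult_diff_distrib)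
qed simp

text \<open>The Pontryagin equations say that the first variation of the reward vanishes, and the reward
  is quadratic in the control.\<close>

lemma reward_deviation:
  assumes x: "hamiltonian_orbit T x p" and S: "transpose S = S" and pT: "p T = S *v x T"
  shows "reward S T (x 0) w = 1/2 * (p 0 \<bullet> x 0) + reward S T 0 (\<lambda>t. w t - feedback p t)"
proof -
  define v where "v t = w t - feedback p t" for t
  define \<delta> where "\<delta> = lq_state A B 0 v"
  define u where "u = feedback p"
  have w: "w t = u t + v t" for t by (simp add: u_def v_def)
  have y: "lq_state A B (x 0) w t = x t + \<delta> t" if "t \<le> T" for t
    using state_deviation[OF x that, of w] unfolding \<delta>_def v_def .
  \<comment> \<open>The first-order terms of the running cost telescope to
    \<open>p T \<bullet> \<delta> T\<close>, the first-order term of the terminal reward, so the two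
    cancel.\<close>
  have lin: "p n \<bullet> \<delta> n = (\<Sum>t<n. x t \<bullet> (Q *v \<delta> t) + u t \<bullet> (R *v v t))" if "n \<le> T" for n
    using that
  proof (induction n)
    case (Suc n)
    then have n: "n < T" by simp
    have "p (Suc n) \<bullet> \<delta> (Suc n)
        = (transpose A *v p (Suc n)) \<bullet> \<delta> n + (transpose B *v p (Suc n)) \<bullet> v n"
      by (simp add: \<delta>_def inner_add_right inner_transpose_left)
    also have "(transpose A *v p (Suc n)) \<bullet> \<delta> n = p n \<bullet> \<delta> n + x n \<bullet> (Q *v \<delta> n)"
      by (simp add: orbit_stepD(2)[OF x n] inner_add_left inner_Q_commute[of "x n" "\<delta> n"])
        (rule inner_commute)
    also have "(transpose B *v p (Suc n)) \<bullet> v n = u n \<bullet> (R *v v n)"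
      unfolding inner_R_commute[of "u n" "v n"] by (simp add: u_def R_feedback inner_commute)
    finally show ?case using Suc by simp
  qed (simp add: \<delta>_def)
  have uu: "u t \<bullet> (R *v u t) = p (Suc t) \<bullet> (G *v p (Suc t))" for t
    unfolding u_def R_feedback inner_G by (simp add: matrix_vector_mul_assoc inner_commute)
  \<comment> \<open>Twice the running cost of the branch is the growth of its energy; together with
    the terminal reward only half of \<open>p 0 \<bullet> x 0\<close> remains.\<close>
  have quad: "p T \<bullet> x T = p 0 \<bullet> x 0 + (\<Sum>t<T. x t \<bullet> (Q *v x t) + u t \<bullet> (R *v u t))"
    using pairing_sum[OF x x order_refl] by (simp add: uu)
  have cross: "x T \<bullet> (S *v \<delta> T) = p T \<bullet> \<delta> T" "\<delta> T \<bullet> (S *v x T) = p T \<bullet> \<delta> T"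
    using symmetric_inner_commute[OF S] by (simp_all add: pT inner_commute)
  have "reward S T (x 0) w = 1/2 * ((x T + \<delta> T) \<bullet> (S *v (x T + \<delta> T)))
      - (\<Sum>t<T. 1/2 * ((x t + \<delta> t) \<bullet> (Q *v (x t + \<delta> t)))
        + 1/2 * ((u t + v t) \<bullet> (R *v (u t + v t))))"
    unfolding lq_reward_def by (simp add: y w)
  also have "(x T + \<delta> T) \<bullet> (S *v (x T + \<delta> T)) = p T \<bullet> x T + 2 * (p T \<bullet> \<delta> T) + \<delta> T \<bullet> (S *v \<delta> T)"
    by (simp add: matrix_vector_right_distrib inner_add_left inner_add_right cross)
      (simp add: pT inner_commute)
  also have "(\<Sum>t<T. 1/2 * ((x t + \<delta> t) \<bullet> (Q *v (x t + \<delta> t)))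
        + 1/2 * ((u t + v t) \<bullet> (R *v (u t + v t))))
      = 1/2 * (\<Sum>t<T. x t \<bullet> (Q *v x t) + u t \<bullet> (R *v u t))
        + (\<Sum>t<T. x t \<bullet> (Q *v \<delta> t) + u t \<bullet> (R *v v t))
        + (\<Sum>t<T. 1/2 * (\<delta> t \<bullet> (Q *v \<delta> t)) + 1/2 * (v t \<bullet> (R *v v t)))"
    unfolding sum_distrib_left sum.distrib[symmetric]
    by (rule sum.cong)
      (simp_all add: matrix_vector_right_distrib inner_add_left inner_add_right
        inner_Q_commute[of "\<delta> _" "x _"] inner_R_commute[of "v _" "u _"] algebra_simps)
  finally have "reward S T (x 0) w = 1/2 * (p T \<bullet> x T) + p T \<bullet> \<delta> T + 1/2 * (\<delta> T \<bullet> (S *v \<delta> T))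
      - 1/2 * (p T \<bullet> x T - p 0 \<bullet> x 0) - p T \<bullet> \<delta> T
      - (\<Sum>t<T. 1/2 * (\<delta> t \<bullet> (Q *v \<delta> t)) + 1/2 * (v t \<bullet> (R *v v t)))"
    using quad lin[OF order_refl] by (simp add: field_simps)
  moreover have "reward S T 0 v = 1/2 * (\<delta> T \<bullet> (S *v \<delta> T))
      - (\<Sum>t<T. 1/2 * (\<delta> t \<bullet> (Q *v \<delta> t)) + 1/2 * (v t \<bullet> (R *v v t)))"
    by (simp add: lq_reward_def \<delta>_def)
  ultimately show ?thesis by (simp add: v_def[abs_def] field_simps)
qed

lemma reward_zero_state_le:
  assumes "symmetric_negsemidef S"
  shows "reward S T 0 v \<le> - (\<Sum>t<T. 1/2 * (v t \<bullet> (R *v v t)))"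
proof -
  define \<delta> where "\<delta> = lq_state A B 0 v"
  have "\<delta> T \<bullet> (S *v \<delta> T) \<le> 0" using assms by (simp add: symmetric_negsemidef_def)
  moreover have "0 \<le> (\<Sum>t<T. 1/2 * (\<delta> t \<bullet> (Q *v \<delta> t)))"
    by (intro sum_nonneg) (simp add: inner_Q_nonneg)
  ultimately show ?thesis unfolding lq_reward_def sum.distrib \<delta>_def[symmetric] by simp
qed

lemma reward_zero_state_neg:
  assumes S: "symmetric_negsemidef S" and t: "t < T" "v t \<noteq> 0"
  shows "reward S T 0 v < 0"
proof -
  have "0 < 1/2 * (v t \<bullet> (R *v v t))"
    using t inner_R_nonneg[of "v t"] inner_R_eq_0_iff[of "v t"] by linarith
  also have "\<dots> \<le> (\<Sum>t<T. 1/2 * (v t \<bullet> (R *v v t)))"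
    using t by (intro member_le_sum) (auto simp: inner_R_nonneg)
  finally show ?thesis using reward_zero_state_le[OF S, of T v] by linarith
qed

lemma state_scale: "lq_state A B 0 (\<lambda>t. c *\<^sub>R v t) t = c *\<^sub>R lq_state A B 0 v t"
  by (induction t) (simp_all add: matrix_vector_mult_scaleR scaleR_right_distrib)

lemma reward_scale: "reward S T 0 (\<lambda>t. c *\<^sub>R v t) = c\<^sup>2 * reward S T 0 v"
  by (simp add: lq_reward_def state_scale matrix_vector_mult_scaleR power2_eq_square
      right_diff_distrib sum_distrib_left algebra_simps)

text \<open>Strict concavity enters as follows: an admissible segment from an interior optimizer towards
  the stationary control strictly increases the reward.\<close>

lemma stationary_branch_optimal:
  assumes br: "stationary_branch A B Q R S T z (u, x, p)" and S: "symmetric_negsemidef S"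
    and U: "U = UNIV \<or> (\<exists>w. lq_optimal A B Q R S U T z w \<and> (\<forall>t<T. w t \<in> interior U))"
  shows "lq_optimal A B Q R S U T z w \<longleftrightarrow> w = u"
    and "lq_value A B Q R S U T z = 1/2 * (p 0 \<bullet> z)"
proof -
  have x: "hamiltonian_orbit T x p" and pT: "p T = S *v x T" and x0: "x 0 = z"
    and u: "\<And>t. t < T \<Longrightarrow> u t = feedback p t" and ext: "u \<in> extensional {..<T}"
    using br by (auto simp: stationary_branch_iff)
  have Ssym: "transpose S = S" using S by (simp add: symmetric_negsemidef_def)
  \<comment> \<open>The reward of \<open>w\<close> minus that of the stationary control. It is
    nonpositive and, on extensional controls, zero only at \<open>u\<close>; the remaining point is
    that \<open>u\<close> is admissible.\<close>
  define q where "q w = reward S T 0 (\<lambda>t. w t - feedback p t)" for w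
  have J: "reward S T z w = 1/2 * (p 0 \<bullet> z) + q w" for w
    using reward_deviation[OF x Ssym pT] by (simp add: x0 q_def)
  have q_le: "q w \<le> 0" for w
  proof -
    have "0 \<le> (\<Sum>t<T. 1/2 * ((w t - feedback p t) \<bullet> (R *v (w t - feedback p t))))"
      by (intro sum_nonneg) (simp add: inner_R_nonneg)
    then show ?thesis
      using reward_zero_state_le[OF S, of T "\<lambda>t. w t - feedback p t"] by (simp add: q_def)
  qed
  have q_neg: "q w < 0" if "t < T" "w t \<noteq> u t" for w t
    unfolding q_def using that u by (intro reward_zero_state_neg[OF S, of t]) auto
  have q_neg': "q w < 0" if w: "w \<in> lq_controls U T" "w \<noteq> u" for w
  proof -
    have "w \<in> extensional {..<T}" using w by (simp add: lq_controls_def PiE_def)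
    then obtain t where "t < T" "w t \<noteq> u t"
      using extensionalityI[OF _ ext] w(2) by (metis lessThan_iff)
    then show ?thesis by (rule q_neg)
  qed
  have qu: "q u = 0"
  proof -
    have "lq_state A B 0 (\<lambda>t. u t - feedback p t) t = 0" if "t \<le> T" for t
      using that by (induction t) (simp_all add: u)
    then show ?thesis by (simp add: q_def lq_reward_def u)
  qed
  have uU: "u \<in> lq_controls U T"
    using U
  proof
    assume "U = UNIV"
    then show ?thesis using ext by (simp add: lq_controls_def PiE_def)
  next
    assume "\<exists>w. lq_optimal A B Q R S U T z w \<and> (\<forall>t<T. w t \<in> interior U)"
    then obtain w where w: "lq_optimal A B Q R S U T z w" and int: "\<And>t. t < T \<Longrightarrow> w t \<in> interior U"
      by blast
    have wc: "w \<in> lq_controls U T" and wmax: "\<And>w'. w' \<in> lq_controls U T \<Longrightarrow> q w' \<le> q w"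
      using w by (auto simp: lq_optimal_def is_arg_max_def J not_less)
    define W where "W s = restrict (\<lambda>t. w t + s *\<^sub>R (u t - w t)) {..<T}" for s :: real
    have "\<forall>\<^sub>F s in at_right 0. w t + s *\<^sub>R (u t - w t) \<in> interior U" if "t < T" for t
    proof -
      have "((\<lambda>s. w t + s *\<^sub>R (u t - w t)) \<longlongrightarrow> w t + 0 *\<^sub>R (u t - w t)) (at_right 0)"
        by (intro tendsto_intros)
      then show ?thesis
        using int[OF that] by (intro topological_tendstoD[of _ "w t"]) auto
    qed
    then have "\<forall>\<^sub>F s in at_right 0. \<forall>t\<in>{..<T}. w t + s *\<^sub>R (u t - w t) \<in> interior U"
      by (subst eventually_ball_finite_distrib) auto
    moreover have "\<forall>\<^sub>F s::real in at_right 0. s \<in> {0<..<1}"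
      by (rule eventually_at_right_real) simp
    ultimately have "\<forall>\<^sub>F s in at_right 0. 0 < s \<and> s < 1 \<and> (\<forall>t<T. w t + s *\<^sub>R (u t - w t) \<in> interior U)"
      by eventually_elim auto
    then obtain s :: real where s: "0 < s" "s < 1"
      and sU: "\<And>t. t < T \<Longrightarrow> w t + s *\<^sub>R (u t - w t) \<in> interior U"
      using eventually_happens'[OF trivial_limit_at_right_real] by blast
    have "W s \<in> lq_controls U T"
      using sU interior_subset by (auto simp: W_def lq_controls_def)
    then have "q (W s) \<le> q w" by (rule wmax)
    \<comment> \<open>Along the segment the deviation from the feedback shrinks by the factor
      \<open>1 - s\<close>, and \<open>q\<close> is quadratic in it. As \<open>q w \<le> 0\<close>,
      maximality of \<open>w\<close> forces \<open>q w = 0\<close>.\<close>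
    moreover have "q (W s) = (1 - s)\<^sup>2 * q w"
    proof -
      have eq: "W s t - feedback p t = (1 - s) *\<^sub>R (w t - feedback p t)" if "t < T" for t
        using that by (simp add: W_def u algebra_simps)
      have st: "lq_state A B 0 (\<lambda>t. W s t - feedback p t) t
          = lq_state A B 0 (\<lambda>t. (1 - s) *\<^sub>R (w t - feedback p t)) t" if "t \<le> T" for t
        using that by (induction t) (simp_all add: eq)
      have "q (W s) = reward S T 0 (\<lambda>t. (1 - s) *\<^sub>R (w t - feedback p t))"
        unfolding q_def lq_reward_def by (simp add: eq st)
      then show ?thesis by (simp only: reward_scale q_def)
    qed
    moreover have "(1 - s)\<^sup>2 < 1" using s by (simp add: power_less_one_iff)
    ultimately have "q w = 0" using q_le[of w] by (smt (verit) mult_less_cancel_right1)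
    then have "w = u" using q_neg'[OF wc] by force
    then show ?thesis using wc by simp
  qed
  show opt: "lq_optimal A B Q R S U T z w \<longleftrightarrow> w = u" for w
  proof -
    have "lq_optimal A B Q R S U T z w \<longleftrightarrow>
        w \<in> lq_controls U T \<and> (\<forall>w'\<in>lq_controls U T. q w' \<le> q w)"
      by (auto simp: lq_optimal_def is_arg_max_def J not_less)
    then show ?thesis using uU q_neg'[of w] q_le qu by (metis not_less)
  qed
  have "lq_value A B Q R S U T z = reward S T z u"
    unfolding lq_value_def by (rule cSup_eq_maximum) (use uU q_le qu in \<open>auto simp: J\<close>)
  then show "lq_value A B Q R S U T z = 1/2 * (p 0 \<bullet> z)" by (simp add: J qu)
qed

end

section \<open>Stable and unstable modes\<close>

lemma opnorm_ge: "norm (A *v x) \<le> opnorm A * norm x" for A :: "real^'n^'k"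
  by (rule onorm) (rule matrix_vector_mul_bounded_linear)

lemma opnorm_nonneg: "0 \<le> opnorm A" for A :: "real^'n^'k"
  by (rule onorm_pos_le) (rule matrix_vector_mul_bounded_linear)

lemma opnorm_mult: "opnorm (A ** B) \<le> opnorm A * opnorm B"
  for A :: "real^'n^'k" and B :: "real^'l^'n"
proof -
  have "(*v) (A ** B) = (*v) A \<circ> (*v) B" by (auto simp: matrix_vector_mul_assoc)
  then show ?thesis by (simp add: onorm_compose matrix_vector_mul_bounded_linear)
qed

text \<open>The choice \<open>x = A *v y\<close> turns the bilinear bound into a bound of
  \<open>norm (A *v y)\<close>.\<close>

lemma opnorm_le_bilinear:
  fixes A :: "real^'n^'k"
  assumes "\<And>x y. \<bar>x \<bullet> (A *v y)\<bar> \<le> c * norm x * norm y"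
  shows "opnorm A \<le> c"
proof (rule onorm_le)
  fix y
  show "norm (A *v y) \<le> c * norm y"
  proof (cases "A *v y = 0")
    case True
    \<comment> \<open>An arbitrary basis vector serves only to show that \<open>c\<close> is
      nonnegative.\<close>
    have "0 \<le> \<bar>axis undefined 1 \<bullet> (A *v axis undefined 1)\<bar>" by simp
    also have "\<dots> \<le> c" using assms[of "axis undefined 1" "axis undefined 1"] by simp
    finally show ?thesis using True by simp
  next
    case False
    have "norm (A *v y) * norm (A *v y) \<le> (c * norm y) * norm (A *v y)"
      using assms[of "A *v y" y] by (simp add: dot_square_norm power2_eq_square mult_ac)
    then show ?thesis using False by simp
  qed
qed

lemma bounded_bilinear_matrix_vector_mult:
  "bounded_bilinear ((*v) :: real^'n^'k \<Rightarrow> real^'n \<Rightarrow> real^'k)"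
  unfolding bilinear_conv_bounded_bilinear[symmetric] bilinear_def
  by (auto intro!: linearI simp: matrix_vector_mult_add_rdistrib matrix_vector_right_distrib
      matrix_vector_mult_scaleR scaleR_matrix_vector_assoc)

lemma symmetric_if_inner_commute:
  fixes A :: "real^'n^'n"
  assumes "\<And>x y. x \<bullet> (A *v y) = y \<bullet> (A *v x)"
  shows "transpose A = A"
proof -
  have "x \<bullet> (transpose A *v y) = x \<bullet> (A *v y)" for x y
    using assms[of x y] inner_transpose_left[of A y x] by (simp add: inner_commute)
  then have "transpose A *v y = A *v y" for y by (metis vector_eq_ldot)
  then show ?thesis by (simp add: matrix_eq)
qed

text \<open>Polarization: the symmetric bilinear form is a difference of two values of the quadratic
  form, and the parallelogram identity adds their bounds without loss in \<open>c\<close>.\<close>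

lemma symmetric_quadratic_bound:
  fixes P :: "real^'n^'n"
  assumes sym: "transpose P = P" and bound: "\<And>z. \<bar>z \<bullet> (P *v z)\<bar> \<le> c * (norm z)\<^sup>2"
  shows "norm (P *v y) \<le> c * norm y"
proof (cases "P *v y = 0 \<or> y = 0")
  case True
  have "0 \<le> \<bar>axis undefined 1 \<bullet> (P *v axis undefined 1)\<bar>" by simp
  also have "\<dots> \<le> c" using bound[of "axis undefined 1"] by simp
  finally show ?thesis using True by auto
next
  case False
  \<comment> \<open>Scaling by \<open>t\<close> gives \<open>x\<close> the norm of \<open>y\<close>,
    so the parallelogram identity yields exactly \<open>4 * (norm y)\<^sup>2\<close>.\<close>
  define t where "t = norm y / norm (P *v y)"
  define x where "x = t *\<^sub>R (P *v y)"
  have nx: "norm x = norm y" using False by (simp add: x_def t_def)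
  have "4 * (x \<bullet> (P *v y)) = (x + y) \<bullet> (P *v (x + y)) - (x - y) \<bullet> (P *v (x - y))"
    using symmetric_inner_commute[OF sym, of y x]
    by (simp add: matrix_vector_right_distrib matrix_vector_mult_diff_distrib inner_add_left
        inner_add_right inner_diff_left inner_diff_right)
  also have "\<dots> \<le> c * ((norm (x + y))\<^sup>2 + (norm (x - y))\<^sup>2)"
    using bound[of "x + y"] bound[of "x - y"] by (simp add: distrib_left)
  also have "(norm (x + y))\<^sup>2 + (norm (x - y))\<^sup>2 = 4 * (norm y)\<^sup>2"
    using nx unfolding norm_eq
    by (simp add: power2_norm_eq_inner inner_add_left inner_add_right inner_diff_left inner_diff_right
        inner_commute)
  finally have "x \<bullet> (P *v y) \<le> c * (norm y)\<^sup>2" by simp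
  moreover have "x \<bullet> (P *v y) = norm y * norm (P *v y)"
    using False by (simp add: x_def t_def dot_square_norm power2_eq_square)
  ultimately have "norm y * norm (P *v y) \<le> norm y * (c * norm y)"
    by (simp add: power2_eq_square mult_ac)
  then show ?thesis using False by simp
qed

section \<open>Matrix powers and block matrices\<close>

lemma mat_power_Suc_right: "mat_power D (Suc k) = mat_power D k ** D"
  by (induction k) (simp_all add: matrix_mul_assoc)

lemma mat_power_intertwine:
  assumes "M ** V = V ** D"
  shows "mat_power M k ** V = V ** mat_power D k"
proof (induction k)
  case (Suc k)
  have "mat_power M (Suc k) ** V = M ** (V ** mat_power D k)"
    by (simp add: Suc[symmetric] matrix_mul_assoc)
  also have "\<dots> = V ** mat_power D (Suc k)" by (simp add: matrix_mul_assoc assms)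
  finally show ?case .
qed simp

lemma mat_power_left_inverse:
  assumes "N ** D = mat 1"
  shows "mat_power N k ** mat_power D k = mat 1"
proof (induction k)
  case (Suc k)
  have "mat_power N (Suc k) ** mat_power D (Suc k) = mat_power N k ** (N ** D) ** mat_power D k"
    unfolding mat_power_Suc_right[of N] by (simp add: matrix_mul_assoc)
  then show ?case by (simp add: assms Suc)
qed simp

lemma matrix_add_rdistrib: "(X + Y) ** Z = X ** Z + Y ** Z"
  by (simp add: matrix_matrix_mult_def vec_eq_iff sum.distrib distrib_right)

lemma sum_UNIV_Plus:
  "(\<Sum>k\<in>(UNIV :: ('a::finite + 'b::finite) set). f k) = (\<Sum>a\<in>UNIV. f (Inl a)) + (\<Sum>b\<in>UNIV. f (Inr b))"
  by (simp add: UNIV_Plus_UNIV[symmetric] sum.Plus del: UNIV_Plus_UNIV)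

lemma vcat_mult: "vcat X P ** D = vcat (X ** D) (P ** D)"
  by (simp add: vcat_def matrix_matrix_mult_def vec_eq_iff split: sum.split)

lemma hcat_mult_vcat: "hcat X P ** vcat Y Z = X ** Y + P ** Z"
  by (simp add: vcat_def hcat_def matrix_matrix_mult_def vec_eq_iff sum_UNIV_Plus)

lemma vcat_eq_iff: "vcat X P = vcat Y Z \<longleftrightarrow> X = Y \<and> P = Z"
  by (force simp: vcat_def vec_eq_iff split: sum.split)

lemma vcat_vector_nth:
  "(vcat X P *v a) $ Inl i = (X *v a) $ i" "(vcat X P *v a) $ Inr j = (P *v a) $ j"
  by (simp_all add: vcat_def matrix_vector_mult_def)

lemma vcat_vector_eq_iff:
  "vcat X P *v a = vcat Y Z *v b \<longleftrightarrow> X *v a = Y *v b \<and> P *v a = Z *v b"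
proof
  assume eq: "vcat X P *v a = vcat Y Z *v b"
  show "X *v a = Y *v b \<and> P *v a = Z *v b"
    using arg_cong[OF eq, of "\<lambda>v. v $ Inl _"] arg_cong[OF eq, of "\<lambda>v. v $ Inr _"]
    by (simp add: vcat_vector_nth vec_eq_iff)
next
  assume "X *v a = Y *v b \<and> P *v a = Z *v b"
  then have "(vcat X P *v a) $ k = (vcat Y Z *v b) $ k" for k
    by (cases k) (simp_all add: vcat_vector_nth)
  then show "vcat X P *v a = vcat Y Z *v b" by (simp add: vec_eq_iff)
qed

lemma norm_vcat_ge:
  fixes X :: "real^'k^'n" and P :: "real^'k^'l"
  shows "norm (X *v a) \<le> norm (vcat X P *v a)" and "norm (P *v a) \<le> norm (vcat X P *v a)"
proof -
  have "(norm (vcat X P *v a))\<^sup>2 = (norm (X *v a))\<^sup>2 + (norm (P *v a))\<^sup>2"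
    unfolding power2_norm_eq_inner by (simp add: inner_vec_def sum_UNIV_Plus vcat_vector_nth)
  then show "norm (X *v a) \<le> norm (vcat X P *v a)" "norm (P *v a) \<le> norm (vcat X P *v a)"
    by (simp_all add: power2_le_imp_le)
qed

lemma columns_basis_of_inj:
  assumes "columns_basis_of V W"
  shows "inj ((*v) V)"
proof -
  have "columns V = range (\<lambda>j. column j V)" by (auto simp: columns_def)
  then have "card (columns V) = CARD('a)"
    using assms by (simp add: columns_basis_of_def card_image)
  moreover have "dim (columns V) = card (columns V)"
    using assms by (simp add: columns_basis_of_def dim_eq_card_independent)
  ultimately have "rank V = CARD('a)" by (simp add: column_rank_def)
  then show ?thesis by (simp add: full_rank_injective)
qed

text \<open>Multiplying the lower block row by \<open>transpose A\<close> removes the inverse, and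
  inserting the lower row into the upper one gives the state equation. Invariance thus becomes the
  implicit form of an orbit step.\<close>

lemma (in lq_problem) hamiltonian_step_blocks:
  assumes "hamiltonian_step A B Q R ** vcat X P = vcat X P ** D"
  shows "X ** D = A ** X + G ** (P ** D)" and "transpose A ** (P ** D) = P + Q ** X"
proof -
  let ?N = "matrix_inv (transpose A)"
  have N: "transpose A ** ?N = mat 1"
    by (rule matrix_inv_right) (rule transpose_invertible[OF A])
  have eqs: "(A + G ** ?N ** Q) ** X + (G ** ?N) ** P = X ** D" "?N ** Q ** X + ?N ** P = P ** D"
    using assms unfolding hamiltonian_step_def Let_def G_def[symmetric]
    by (simp_all add: vcat_mult hcat_mult_vcat vcat_eq_iff)
  have "A ** X + G ** (P ** D) = (A + G ** ?N ** Q) ** X + (G ** ?N) ** P"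
    unfolding eqs(2)[symmetric]
    by (simp add: matrix_add_ldistrib matrix_add_rdistrib matrix_mul_assoc)
  then show "X ** D = A ** X + G ** (P ** D)" using eqs(1) by simp
  have "transpose A ** (P ** D) = (transpose A ** ?N) ** Q ** X + (transpose A ** ?N) ** P"
    unfolding eqs(2)[symmetric] by (simp add: matrix_add_ldistrib matrix_mul_assoc)
  then show "transpose A ** (P ** D) = P + Q ** X" by (simp add: N)
qed

lemma (in lq_problem) mode_step:
  assumes "hamiltonian_step A B Q R ** vcat X P = vcat X P ** D"
  shows "X *v (D *v e) = A *v (X *v e) + G *v (P *v (D *v e))"
    and "transpose A *v (P *v (D *v e)) = P *v e + Q *v (X *v e)"
proof -
  note blocks = hamiltonian_step_blocks[OF assms]
  have "X *v (D *v e) = (X ** D) *v e" by (simp only: matrix_vector_mul_assoc)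
  also have "\<dots> = A *v (X *v e) + G *v (P *v (D *v e))"
    by (simp only: blocks(1) matrix_vector_mult_add_rdistrib matrix_vector_mul_assoc[symmetric])
  finally show "X *v (D *v e) = A *v (X *v e) + G *v (P *v (D *v e))" .
  have "transpose A *v (P *v (D *v e)) = (transpose A ** (P ** D)) *v e"
    by (simp only: matrix_vector_mul_assoc matrix_mul_assoc)
  also have "\<dots> = P *v e + Q *v (X *v e)"
    by (simp only: blocks(2) matrix_vector_mult_add_rdistrib matrix_vector_mul_assoc)
  finally show "transpose A *v (P *v (D *v e)) = P *v e + Q *v (X *v e)" .
qed

text \<open>The splitting enters through injective, invariant blocks and through decay: forwards
  along powers of \<open>Ds\<close>, backwards along powers of the inverse of
  \<open>Du\<close>.\<close>

locale lq_dichotomy = lq_problem A Q B R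
  for A Q :: "real^'d^'d" and B :: "real^'m^'d" and R :: "real^'m^'m" +
  fixes Xs Ps Xu Pu Ds Du :: "real^'d^'d" and K \<gamma> :: real
  assumes AB: "stabilizable A B"
    and inj_s: "inj ((*v) (vcat Xs Ps))" and inj_u: "inj ((*v) (vcat Xu Pu))"
    and Ds: "hamiltonian_step A B Q R ** vcat Xs Ps = vcat Xs Ps ** Ds"
    and Du: "hamiltonian_step A B Q R ** vcat Xu Pu = vcat Xu Pu ** Du"
    and K: "K \<ge> 1" and \<gamma>: "\<gamma> > 0"
    and decay_s: "\<And>k. opnorm (vcat Xs Ps ** mat_power Ds k) \<le> K * exp (- \<gamma> * real k)"
    and decay_u: "\<And>k. opnorm (vcat Xu Pu ** mat_power (matrix_inv Du) k)
                       \<le> K * exp (- \<gamma> * real k)"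
begin

section \<open>Decay and independence of the modes, invertible blocks\<close>

lemma kernel_s: "Xs *v a = 0 \<Longrightarrow> Ps *v a = 0 \<Longrightarrow> a = 0"
  using injD[OF inj_s, of a 0] vcat_vector_eq_iff[of Xs Ps a Xs Ps 0] by simp

lemma kernel_u: "Xu *v a = 0 \<Longrightarrow> Pu *v a = 0 \<Longrightarrow> a = 0"
  using injD[OF inj_u, of a 0] vcat_vector_eq_iff[of Xu Pu a Xu Pu 0] by simp

lemma A_cancel: "A *v x = 0 \<Longrightarrow> x = 0"
  using matrix_vector_mul_assoc[of "matrix_inv A" A x] by (simp add: matrix_inv_left[OF A])

text \<open>As \<open>A\<close> is invertible, an orbit step that arrives at zero started at zero.
  Hence \<open>matrix_inv Du\<close> is a genuine inverse.\<close>

lemma invertible_Du: "invertible Du"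
proof (rule invertible_if_kernel_zero)
  fix b
  assume b: "Du *v b = 0"
  have X: "Xu *v b = 0" using mode_step(1)[OF Du, of b] by (simp add: b A_cancel)
  then have "Pu *v b = 0" using mode_step(2)[OF Du, of b] by (simp add: b)
  with X show "b = 0" by (rule kernel_u)
qed

lemma exp_decay_tendsto: "(\<lambda>k. c * exp (- \<gamma> * real k)) \<longlonglongrightarrow> 0"
proof -
  have "exp (- \<gamma> * real k) = exp (- \<gamma>) ^ k" for k
    using exp_of_nat_mult[of k "- \<gamma>"] by (simp add: mult.commute)
  then have "(\<lambda>k. exp (- \<gamma> * real k)) \<longlonglongrightarrow> 0" using \<gamma> by (simp add: LIMSEQ_realpow_zero)
  then show ?thesis by (rule tendsto_mult_right_zero)
qed

lemma norm_mode_s: "norm (vcat Xs Ps *v (mat_power Ds k *v a)) \<le> K * exp (- \<gamma> * real k) * norm a"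
  using order_trans[OF opnorm_ge mult_right_mono[OF decay_s norm_ge_zero]]
  by (simp add: matrix_vector_mul_assoc)

lemma norm_mode_u:
  "norm (vcat Xu Pu *v (mat_power (matrix_inv Du) k *v a)) \<le> K * exp (- \<gamma> * real k) * norm a"
  using order_trans[OF opnorm_ge mult_right_mono[OF decay_u norm_ge_zero]]
  by (simp add: matrix_vector_mul_assoc)

lemmas norm_Xs = order_trans[OF norm_vcat_ge(1) norm_mode_s]
lemmas norm_Ps = order_trans[OF norm_vcat_ge(2) norm_mode_s]
lemmas norm_Xu = order_trans[OF norm_vcat_ge(1) norm_mode_u]
lemmas norm_Pu = order_trans[OF norm_vcat_ge(2) norm_mode_u]

lemma tendsto_0_if_decay:
  fixes f :: "nat \<Rightarrow> 'a::real_normed_vector"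
  assumes "\<And>k. norm (f k) \<le> K * exp (- \<gamma> * real k) * c"
  shows "f \<longlonglongrightarrow> 0"
  by (rule Lim_null_comparison[OF always_eventually exp_decay_tendsto[of "K * c"]])
    (use assms in \<open>simp add: mult_ac\<close>)

lemmas tendsto_Xs = tendsto_0_if_decay[OF norm_Xs]
lemmas tendsto_Ps = tendsto_0_if_decay[OF norm_Ps]
lemmas tendsto_Xu = tendsto_0_if_decay[OF norm_Xu]
lemmas tendsto_Pu = tendsto_0_if_decay[OF norm_Pu]

text \<open>A stable mode with coordinate \<open>a\<close> at time 0 plus an unstable mode with
  coordinate \<open>b\<close> at time \<open>T\<close>. Normalized at opposite ends, both involve
  only decaying powers.\<close>

definition mode_state :: "nat \<Rightarrow> real^'d \<Rightarrow> real^'d \<Rightarrow> nat \<Rightarrow> real^'d"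
  where "mode_state T a b t =
    Xs *v (mat_power Ds t *v a) + Xu *v (mat_power (matrix_inv Du) (T - t) *v b)"

definition mode_costate :: "nat \<Rightarrow> real^'d \<Rightarrow> real^'d \<Rightarrow> nat \<Rightarrow> real^'d"
  where "mode_costate T a b t =
    Ps *v (mat_power Ds t *v a) + Pu *v (mat_power (matrix_inv Du) (T - t) *v b)"

lemma orbit_mode: "hamiltonian_orbit T (mode_state T a b) (mode_costate T a b)"
  unfolding hamiltonian_orbit_def
proof (intro allI impI)
  fix t
  assume t: "t < T"
  define e where "e = mat_power Ds t *v a"
  define f where "f = mat_power (matrix_inv Du) (T - t) *v b"
  have e: "mat_power Ds (Suc t) *v a = Ds *v e" by (simp add: e_def matrix_vector_mul_assoc)
  \<comment> \<open>Truncated subtraction is harmless because \<open>t < T\<close>: one forward step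
    removes exactly one factor \<open>matrix_inv Du\<close>.\<close>
  have "T - t = Suc (T - Suc t)" using t by simp
  then have "Du *v f = (Du ** matrix_inv Du) *v (mat_power (matrix_inv Du) (T - Suc t) *v b)"
    by (simp only: f_def mat_power.simps matrix_vector_mul_assoc matrix_mul_assoc)
  then have f: "mat_power (matrix_inv Du) (T - Suc t) *v b = Du *v f"
    by (simp add: matrix_inv_right[OF invertible_Du])
  show "mode_state T a b (Suc t) = A *v mode_state T a b t + G *v mode_costate T a b (Suc t) \<and>
      mode_costate T a b t = transpose A *v mode_costate T a b (Suc t) - Q *v mode_state T a b t"
    unfolding mode_state_def mode_costate_def e f e_def[symmetric] f_def[symmetric]
    by (simp add: mode_step(1)[OF Ds] mode_step(1)[OF Du] matrix_vector_right_distrib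
        mode_step(2)[OF Ds] mode_step(2)[OF Du] del: mat_power.simps)
qed

text \<open>A vector common to both ranges decays forwards as a stable mode; pulled back along the
  unstable mode it gains a second decaying factor. This bounds a quantity that does not depend on
  \<open>k\<close>, so it is zero.\<close>

lemma modes_independent:
  assumes "Xs *v a + Xu *v b = 0" "Ps *v a + Pu *v b = 0"
  shows "a = 0" and "b = 0"
proof -
  let ?M = "hamiltonian_step A B Q R" and ?Vs = "vcat Xs Ps" and ?Vu = "vcat Xu Pu"
  obtain \<beta> where \<beta>: "\<beta> > 0" "\<And>y. \<beta> * norm y \<le> norm (?Vu *v y)"
    using linear_inj_bounded_below_pos[OF matrix_vector_mul_linear inj_u] by blast
  have "Xs *v a = Xu *v (- b) \<and> Ps *v a = Pu *v (- b)"
    using assms by (simp add: linear_neg[OF matrix_vector_mul_linear] eq_neg_iff_add_eq_0)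
  then have "?Vs *v a = ?Vu *v (- b)" by (simp only: vcat_vector_eq_iff)
  have "\<beta> * (\<beta> * norm b) \<le> K * K * norm a * exp (- \<gamma> * real k)" for k
  proof -
    define c where "c = mat_power Du k *v (- b)"
    have b: "mat_power (matrix_inv Du) k *v c = - b"
      by (simp add: c_def matrix_vector_mul_assoc
          mat_power_left_inverse[OF matrix_inv_left[OF invertible_Du]])
    have "?Vs *v (mat_power Ds k *v a) = mat_power ?M k *v (?Vs *v a)"
      by (simp add: matrix_vector_mul_assoc mat_power_intertwine[OF Ds])
    also have "\<dots> = ?Vu *v c"
      unfolding \<open>?Vs *v a = ?Vu *v (- b)\<close> c_def
      by (simp add: matrix_vector_mul_assoc mat_power_intertwine[OF Du])
    finally have c_le: "\<beta> * norm c \<le> K * exp (- \<gamma> * real k) * norm a"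
      using \<beta>(2)[of c] norm_mode_s[of k a] by simp
    have b_le: "\<beta> * norm b \<le> K * exp (- \<gamma> * real k) * norm c"
      using \<beta>(2)[of "- b"] norm_mode_u[of k c] by (simp add: b)
    have "\<beta> * (\<beta> * norm b) \<le> K * exp (- \<gamma> * real k) * (K * exp (- \<gamma> * real k) * norm a)"
    proof -
      have "\<beta> * (\<beta> * norm b) \<le> \<beta> * (K * exp (- \<gamma> * real k) * norm c)"
        using b_le \<beta>(1) by (intro mult_left_mono) auto
      also have "\<dots> = K * exp (- \<gamma> * real k) * (\<beta> * norm c)" by (simp only: mult_ac)
      also have "\<dots> \<le> K * exp (- \<gamma> * real k) * (K * exp (- \<gamma> * real k) * norm a)"
        using c_le K by (intro mult_left_mono) auto
      finally show ?thesis .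
    qed
    \<comment> \<open>One exponential factor suffices for the limit; the other is bounded by
      1.\<close>
    also have "\<dots> \<le> K * 1 * (K * exp (- \<gamma> * real k) * norm a)"
      using K \<gamma> by (intro mult_right_mono mult_left_mono) auto
    finally show ?thesis by (simp add: mult_ac)
  qed
  then have "\<beta> * (\<beta> * norm b) \<le> 0"
    using LIMSEQ_le_const[OF exp_decay_tendsto] by blast
  then show b: "b = 0" using \<beta>(1) by (simp add: mult_le_0_iff)
  then show "a = 0" using assms kernel_s by simp
qed

text \<open>If \<open>Xs *v a = 0\<close>, the stable orbit has energy 0 initially and in the limit,
  so every increment vanishes. The states are zero and the costates form a decaying sequence killed
  by \<open>transpose B\<close>, to which stabilizability applies.\<close>

lemma invertible_Xs: "invertible Xs"
proof (rule invertible_if_kernel_zero)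
  fix a
  assume a: "Xs *v a = 0"
  let ?x = "\<lambda>t. Xs *v (mat_power Ds t *v a)" and ?p = "\<lambda>t. Ps *v (mat_power Ds t *v a)"
  have orb: "hamiltonian_orbit T ?x ?p" for T
    using orbit_mode[of T a 0] by (simp add: mode_state_def[abs_def] mode_costate_def[abs_def])
  have x0: "?p 0 \<bullet> ?x 0 = 0" by (simp add: a)
  have lim: "(\<lambda>T. ?p T \<bullet> ?x T) \<longlonglongrightarrow> 0"
    using tendsto_inner[OF tendsto_Ps tendsto_Xs] by simp
  have stop: "?x t = 0 \<and> transpose B *v ?p (Suc t) = 0" for t
  proof -
    have "?x t \<bullet> (Q *v ?x t) + ?p (Suc t) \<bullet> (G *v ?p (Suc t)) \<le> ?p T \<bullet> ?x T" if "T \<ge> Suc t" for T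
      using energy_ge[OF orb, of t T] x0 that by simp
    then have "?x t \<bullet> (Q *v ?x t) + ?p (Suc t) \<bullet> (G *v ?p (Suc t)) \<le> 0"
      by (intro LIMSEQ_le_const[OF lim]) blast
    then have "?x t \<bullet> (Q *v ?x t) = 0" "?p (Suc t) \<bullet> (G *v ?p (Suc t)) = 0"
      using inner_Q_nonneg[of "?x t"] inner_G_nonneg[of "?p (Suc t)"] by linarith+
    then show ?thesis by (simp add: inner_Q_eq_0_iff inner_G_eq_0_iff)
  qed
  have step: "?p t = transpose A *v ?p (Suc t)" for t
    using orbit_stepD(2)[OF orb, of t "Suc t"] stop[of t] by simp
  \<comment> \<open>The kernel condition is available from time 1 on, hence the shifted sequence;
    one costate step then returns to time 0.\<close>
  have "?p (Suc 0) = 0"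
  proof (rule stabilizable_decaying_costate_zero[OF AB A, of "\<lambda>t. ?p (Suc t)"])
    show "?p (Suc t) = transpose A *v ?p (Suc (Suc t))" for t by (rule step)
    show "transpose B *v ?p (Suc t) = 0" for t using stop[of t] by (rule conjunct2)
    show "(\<lambda>t. ?p (Suc t)) \<longlonglongrightarrow> 0" by (rule LIMSEQ_Suc[OF tendsto_Ps])
  qed
  then have "Ps *v a = 0" using step[of 0] by simp
  with a show "a = 0" by (rule kernel_s)
qed

text \<open>A kernel vector \<open>b\<close> gives an unstable orbit whose final energy is
  nonpositive. Its initial energy tends to 0 as the horizon grows, so the last increment vanishes,
  and with it the endpoint.\<close>

lemma invertible_boundary:
  assumes S: "symmetric_negsemidef S"
  shows "invertible (Pu - S ** Xu)"
proof (rule invertible_if_kernel_zero)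
  fix b
  assume "(Pu - S ** Xu) *v b = 0"
  then have b: "Pu *v b = S *v (Xu *v b)"
    by (simp add: matrix_vector_mult_diff_rdistrib matrix_vector_mul_assoc)
  \<comment> \<open>The state one step before the end, the same for every horizon, which permits the
    limit.\<close>
  define y where "y = Xu *v (matrix_inv Du *v b)"
  have le: "(Xu *v b) \<bullet> (Pu *v b) \<le> 0" using S by (simp add: b symmetric_negsemidef_def)
  let ?x0 = "\<lambda>T. Xu *v (mat_power (matrix_inv Du) T *v b)"
    and ?p0 = "\<lambda>T. Pu *v (mat_power (matrix_inv Du) T *v b)"
  have "?p0 (Suc T) \<bullet> ?x0 (Suc T) \<le> - (y \<bullet> (Q *v y) + (Pu *v b) \<bullet> (G *v (Pu *v b)))" for T
    using energy_ge[OF orbit_mode[of "Suc T" 0 b], of T] le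
    by (simp add: mode_state_def mode_costate_def y_def inner_commute)
  moreover have "(\<lambda>T. ?p0 (Suc T) \<bullet> ?x0 (Suc T)) \<longlonglongrightarrow> 0"
    using LIMSEQ_Suc[OF tendsto_inner[OF tendsto_Pu tendsto_Xu]] by simp
  ultimately have "0 \<le> - (y \<bullet> (Q *v y) + (Pu *v b) \<bullet> (G *v (Pu *v b)))"
    using LIMSEQ_le_const2 by blast
  then have "y \<bullet> (Q *v y) = 0" "(Pu *v b) \<bullet> (G *v (Pu *v b)) = 0"
    using inner_Q_nonneg[of y] inner_G_nonneg[of "Pu *v b"] by linarith+
  then have "y = 0" "transpose B *v (Pu *v b) = 0"
    by (simp_all add: inner_Q_eq_0_iff inner_G_eq_0_iff)
  moreover have "Xu *v b = A *v y + G *v (Pu *v b)"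
    using mode_step(1)[OF Du, of "matrix_inv Du *v b"]
    by (simp add: y_def matrix_vector_mul_assoc[of Du] matrix_inv_right[OF invertible_Du])
  ultimately have X: "Xu *v b = 0" by (simp add: G_eq_0)
  then have "Pu *v b = 0" by (simp add: b)
  with X show "b = 0" by (rule kernel_u)
qed

end

section \<open>Riccati matrices\<close>

context lq_dichotomy
begin

text \<open>This is \<open>C_u^{-1} C_s\<close>. If the stable part at the final time has coordinate
  \<open>e\<close>, the terminal condition makes the unstable coordinate minus the image of
  \<open>e\<close>.\<close>

definition boundary_map :: "real^'d^'d \<Rightarrow> real^'d^'d"
  where "boundary_map S = matrix_inv (Pu - S ** Xu) ** (Ps - S ** Xs)"

definition initial_state_map :: "real^'d^'d \<Rightarrow> nat \<Rightarrow> real^'d^'d"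
  where "initial_state_map S T = Xs - Xu ** ric_error Xs Ps Xu Pu Ds Du S T"

definition riccati :: "real^'d^'d \<Rightarrow> nat \<Rightarrow> real^'d^'d"
  where "riccati S T =
    (Ps - Pu ** ric_error Xs Ps Xu Pu Ds Du S T) ** matrix_inv (initial_state_map S T)"

text \<open>The map from initial to final state along the branch. At time \<open>T\<close> the
  unstable mode carries no power of its own, so both parts share the factor
  \<open>mat_power Ds T\<close>.\<close>

definition closed_loop :: "real^'d^'d \<Rightarrow> nat \<Rightarrow> real^'d^'d"
  where "closed_loop S T =
    (Xs - Xu ** boundary_map S) ** mat_power Ds T ** matrix_inv (initial_state_map S T)"

abbreviation unstable_part :: "real^'d^'d \<Rightarrow> nat \<Rightarrow> real^'d \<Rightarrow> real^'d"
  where "unstable_part S T a \<equiv> - (boundary_map S *v (mat_power Ds T *v a))"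

lemma ric_error_vector:
  "ric_error Xs Ps Xu Pu Ds Du S T *v a
    = mat_power (matrix_inv Du) T *v (boundary_map S *v (mat_power Ds T *v a))"
  by (simp add: ric_error_def boundary_map_def matrix_vector_mul_assoc matrix_mul_assoc)

lemmas mult_neg_vector = linear_neg[OF matrix_vector_mul_linear]

lemma mode_initial:
  "mode_state T a (unstable_part S T a) 0 = initial_state_map S T *v a"
  "mode_costate T a (unstable_part S T a) 0
    = (Ps - Pu ** ric_error Xs Ps Xu Pu Ds Du S T) *v a"
  by (simp_all add: mode_state_def mode_costate_def initial_state_map_def mult_neg_vector
      matrix_vector_mult_diff_rdistrib matrix_vector_mul_assoc[symmetric] ric_error_vector)

lemma mode_terminal_state:
  "mode_state T a (unstable_part S T a) T = (Xs - Xu ** boundary_map S) *v (mat_power Ds T *v a)"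
  by (simp add: mode_state_def mult_neg_vector
      matrix_vector_mult_diff_rdistrib matrix_vector_mul_assoc[symmetric])

lemma mode_terminal_costate:
  assumes S: "symmetric_negsemidef S"
  shows "mode_costate T a (unstable_part S T a) T = S *v mode_state T a (unstable_part S T a) T"
proof -
  define e where "e = mat_power Ds T *v a"
  have "(Pu - S ** Xu) *v (boundary_map S *v e) = (Ps - S ** Xs) *v e"
    by (simp add: boundary_map_def matrix_vector_mul_assoc matrix_mul_assoc
        matrix_inv_right[OF invertible_boundary[OF S]])
  then show ?thesis
    unfolding mode_state_def mode_costate_def e_def[symmetric]
    by (simp add: mult_neg_vector matrix_vector_mult_diff_rdistrib matrix_vector_mult_diff_distrib
        matrix_vector_mul_assoc[symmetric] algebra_simps)
qed

text \<open>A kernel vector gives an orbit with zero initial state, hence with zero costate by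
  \<open>orbit_zero\<close>; independence of the modes concludes.\<close>

lemma invertible_initial_state_map:
  assumes S: "symmetric_negsemidef S"
  shows "invertible (initial_state_map S T)"
proof (rule invertible_if_kernel_zero)
  fix a
  assume "initial_state_map S T *v a = 0"
  then have x0: "mode_state T a (unstable_part S T a) 0 = 0" by (simp add: mode_initial)
  have "mode_costate T a (unstable_part S T a) 0 = 0"
    using orbit_zero[OF orbit_mode S mode_terminal_costate[OF S] x0, of 0] by simp
  with x0 show "a = 0"
    by (intro modes_independent(1)[of a "mat_power (matrix_inv Du) T *v unstable_part S T a"])
      (simp_all add: mode_state_def mode_costate_def)
qed

definition optimal_state :: "real^'d^'d \<Rightarrow> nat \<Rightarrow> real^'d \<Rightarrow> nat \<Rightarrow> real^'d"
  where "optimal_state S T z =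
    (let a = matrix_inv (initial_state_map S T) *v z in mode_state T a (unstable_part S T a))"

definition optimal_costate :: "real^'d^'d \<Rightarrow> nat \<Rightarrow> real^'d \<Rightarrow> nat \<Rightarrow> real^'d"
  where "optimal_costate S T z =
    (let a = matrix_inv (initial_state_map S T) *v z in mode_costate T a (unstable_part S T a))"

lemma orbit_optimal: "hamiltonian_orbit T (optimal_state S T z) (optimal_costate S T z)"
  by (simp add: optimal_state_def optimal_costate_def Let_def orbit_mode)

lemma optimal_boundary:
  assumes S: "symmetric_negsemidef S"
  shows "optimal_state S T z 0 = z" and "optimal_costate S T z 0 = riccati S T *v z"
    and "optimal_state S T z T = closed_loop S T *v z"
    and "optimal_costate S T z T = S *v (closed_loop S T *v z)"
  unfolding optimal_state_def optimal_costate_def Let_def mode_initial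
    mode_terminal_costate[OF S] mode_terminal_state riccati_def closed_loop_def
  by (simp_all add: matrix_vector_mul_assoc matrix_mul_assoc
      matrix_inv_right[OF invertible_initial_state_map[OF S]])

text \<open>The conserved symplectic form, evaluated at both ends of two optimal orbits.\<close>

lemma riccati_difference:
  assumes S: "symmetric_negsemidef S" and S': "symmetric_negsemidef S'"
  shows "(riccati S T *v z) \<bullet> z' - (riccati S' T *v z') \<bullet> z
    = (closed_loop S T *v z) \<bullet> ((S - S') *v (closed_loop S' T *v z'))"
proof -
  have "transpose S = S" using S by (simp add: symmetric_negsemidef_def)
  from symmetric_inner_commute[OF this, of "closed_loop S T *v z" "closed_loop S' T *v z'"]
  show ?thesis
    using symplectic[OF orbit_optimal orbit_optimal, of S T z S' z']
    by (simp add: optimal_boundary[OF S] optimal_boundary[OF S'] matrix_vector_mult_diff_rdistrib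
        inner_diff_right inner_commute)
qed

text \<open>For equal terminal matrices the right side of \<open>riccati_difference\<close>
  vanishes.\<close>

lemma riccati_symmetric:
  assumes S: "symmetric_negsemidef S"
  shows "transpose (riccati S T) = riccati S T"
  by (rule symmetric_if_inner_commute)
    (use riccati_difference[OF S S, of T] in \<open>simp add: inner_commute\<close>)

lemma riccati_difference_inner:
  assumes S: "symmetric_negsemidef S" and S': "symmetric_negsemidef S'"
  shows "z \<bullet> ((riccati S T - riccati S' T) *v z')
    = (closed_loop S T *v z) \<bullet> ((S - S') *v (closed_loop S' T *v z'))"
  using riccati_difference[OF S S', of T z z']
    symmetric_inner_commute[OF riccati_symmetric[OF S, of T], of z z']
  by (simp add: matrix_vector_mult_diff_rdistrib inner_diff_right inner_commute)

lemma orbit_s: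
  "hamiltonian_orbit T (\<lambda>t. Xs *v (mat_power Ds t *v a)) (\<lambda>t. Ps *v (mat_power Ds t *v a))"
  using orbit_mode[of T a 0] by (simp add: mode_state_def[abs_def] mode_costate_def[abs_def])

abbreviation riccati_limit :: "real^'d^'d"
  where "riccati_limit \<equiv> Ps ** matrix_inv Xs"

lemma riccati_limit_Xs: "riccati_limit ** Xs = Ps"
  by (simp add: matrix_mul_assoc[symmetric] matrix_inv_left[OF invertible_Xs])

text \<open>Along stable orbits the symplectic form and the energy tend to 0. Constancy of the form
  gives the symmetry, monotonicity of the energy the sign.\<close>

lemma riccati_limit_negsemidef: "symmetric_negsemidef riccati_limit"
  unfolding symmetric_negsemidef_def
proof
  let ?a = "\<lambda>z. matrix_inv Xs *v z"
  have X: "Xs *v ?a z = z" for z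
    by (simp add: matrix_vector_mul_assoc matrix_inv_right[OF invertible_Xs])
  have P: "Ps *v ?a z = riccati_limit *v z" for z by (simp add: matrix_vector_mul_assoc)
  let ?x = "\<lambda>z t. Xs *v (mat_power Ds t *v ?a z)" and ?p = "\<lambda>z t. Ps *v (mat_power Ds t *v ?a z)"
  have lim: "(\<lambda>T. ?p y T \<bullet> ?x z T) \<longlonglongrightarrow> 0" for y z
    using tendsto_inner[OF tendsto_Ps tendsto_Xs] by simp
  show "transpose riccati_limit = riccati_limit"
  proof (rule symmetric_if_inner_commute)
    fix y z
    have "(\<lambda>T. ?p y T \<bullet> ?x z T - ?p z T \<bullet> ?x y T) \<longlonglongrightarrow> 0 - 0"
      by (intro tendsto_diff lim)
    moreover have "?p y T \<bullet> ?x z T - ?p z T \<bullet> ?x y T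
        = (riccati_limit *v y) \<bullet> z - (riccati_limit *v z) \<bullet> y" for T
      using symplectic[OF orbit_s[of T "?a y"] orbit_s[of T "?a z"]] by (simp add: X P)
    ultimately have "(riccati_limit *v y) \<bullet> z - (riccati_limit *v z) \<bullet> y = 0"
      by (simp add: LIMSEQ_const_iff)
    then show "y \<bullet> (riccati_limit *v z) = z \<bullet> (riccati_limit *v y)"
      by (simp add: inner_commute)
  qed
  show "\<forall>z. z \<bullet> (riccati_limit *v z) \<le> 0"
  proof
    fix z
    have "(riccati_limit *v z) \<bullet> z \<le> ?p z T \<bullet> ?x z T" for T
      using energy_mono[OF orbit_s[of T "?a z"]] by (simp add: X P)
    then have "(riccati_limit *v z) \<bullet> z \<le> 0" by (intro LIMSEQ_le_const[OF lim]) blast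
    then show "z \<bullet> (riccati_limit *v z) \<le> 0" by (simp add: inner_commute)
  qed
qed

text \<open>For \<open>S = riccati_limit\<close> the matrix \<open>Ps - S ** Xs\<close> is zero, so
  the branch has no unstable part.\<close>

lemma riccati_limit_fixed:
  shows "riccati riccati_limit T = riccati_limit"
    and "closed_loop riccati_limit T = Xs ** mat_power Ds T ** matrix_inv Xs"
  by (simp_all add: riccati_def closed_loop_def initial_state_map_def ric_error_def boundary_map_def
      riccati_limit_Xs)

section \<open>Estimates uniform in the horizon\<close>

lemma norm_closed_loop_limit:
  "norm (closed_loop riccati_limit T *v z) \<le> K * opnorm (matrix_inv Xs) * norm z"
proof -
  have "norm (closed_loop riccati_limit T *v z) \<le> K * exp (- \<gamma> * real T) * norm (matrix_inv Xs *v z)"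
    using norm_Xs[of T "matrix_inv Xs *v z"]
    by (simp add: riccati_limit_fixed(2) matrix_vector_mul_assoc matrix_mul_assoc)
  also have "\<dots> \<le> K * 1 * (opnorm (matrix_inv Xs) * norm z)"
    using K \<gamma> by (intro mult_mono opnorm_ge) auto
  finally show ?thesis by (simp add: mult_ac)
qed

text \<open>The lower bound compares with the orbit for the infinite horizon; monotonicity of the energy
  along the difference of the two orbits replaces the comparison of their rewards.\<close>

lemma riccati_bounds:
  assumes S: "symmetric_negsemidef S"
  shows "z \<bullet> (riccati S T *v z) \<le> 0"
    and "z \<bullet> (riccati_limit *v z)
      + (closed_loop riccati_limit T *v z) \<bullet> (S *v (closed_loop riccati_limit T *v z))
      \<le> z \<bullet> (riccati S T *v z)"
proof -
  let ?L = riccati_limit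
  let ?x = "closed_loop S T *v z" and ?y = "closed_loop ?L T *v z"
  note L = riccati_limit_negsemidef
  have Sneg: "w \<bullet> (S *v w) \<le> 0" and Lneg: "w \<bullet> (?L *v w) \<le> 0" for w
    using S L by (auto simp: symmetric_negsemidef_def)
  show "z \<bullet> (riccati S T *v z) \<le> 0"
    using energy_mono[OF orbit_optimal, of S T z] Sneg[of ?x]
    by (simp add: optimal_boundary[OF S] inner_commute)
  \<comment> \<open>Both orbits start at \<open>z\<close>, so their difference has initial energy 0
    and nonnegative final energy.\<close>
  have "0 \<le> (?x - ?y) \<bullet> (S *v ?x - ?L *v ?y)"
    using energy_mono[OF orbit_diff[OF orbit_optimal orbit_optimal], of S T z ?L z]
    by (simp add: optimal_boundary[OF S] optimal_boundary[OF L] inner_commute)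
  also have "\<dots> = (?x - ?y) \<bullet> (S *v (?x - ?y)) + (?x - ?y) \<bullet> ((S - ?L) *v ?y)"
    by (simp add: matrix_vector_mult_diff_rdistrib matrix_vector_mult_diff_distrib inner_diff_right)
  finally have "0 \<le> (?x - ?y) \<bullet> ((S - ?L) *v ?y)" using Sneg[of "?x - ?y"] by linarith
  moreover have "z \<bullet> (riccati S T *v z) = z \<bullet> (?L *v z) + ?x \<bullet> ((S - ?L) *v ?y)"
    using riccati_difference_inner[OF S L, of z T z]
    by (simp add: riccati_limit_fixed(1) matrix_vector_mult_diff_rdistrib inner_diff_right)
  \<comment> \<open>The inequality replaces \<open>?x\<close> by \<open>?y\<close>; the nonnegative
    term \<open>- (?y \<bullet> (?L *v ?y))\<close> is dropped.\<close>
  ultimately show "z \<bullet> (?L *v z) + ?y \<bullet> (S *v ?y) \<le> z \<bullet> (riccati S T *v z)"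
    using Lneg[of ?y] by (simp add: inner_diff_left matrix_vector_mult_diff_rdistrib inner_diff_right)
qed

text \<open>The quadratic form lies between 0 and a lower bound that is uniform in \<open>T\<close>,
  because the closed loop of the limit is bounded; by symmetry the form controls the norm.\<close>

lemma norm_riccati_le:
  assumes s: "0 \<le> s"
  obtains c where "0 \<le> c"
    "\<And>S T z. symmetric_negsemidef S \<Longrightarrow> opnorm S \<le> s \<Longrightarrow> norm (riccati S T *v z) \<le> c * norm z"
proof
  let ?k = "K * opnorm (matrix_inv Xs)"
  define c where "c = opnorm riccati_limit + s * ?k\<^sup>2"
  show c0: "0 \<le> c" using s by (simp add: c_def opnorm_nonneg)
  fix S :: "real^'d^'d" and T z
  assume S: "symmetric_negsemidef S" and Ss: "opnorm S \<le> s"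
  have inner_le: "\<bar>w \<bullet> (M *v w)\<bar> \<le> opnorm M * (norm w)\<^sup>2" for M :: "real^'d^'d" and w
    using order_trans[OF Cauchy_Schwarz_ineq2 mult_left_mono[OF opnorm_ge norm_ge_zero]]
    by (simp add: power2_eq_square mult_ac)
  show "norm (riccati S T *v z) \<le> c * norm z"
  proof (rule symmetric_quadratic_bound[OF riccati_symmetric[OF S]])
    fix w
    let ?y = "closed_loop riccati_limit T *v w"
    have "opnorm S * (norm ?y)\<^sup>2 \<le> s * (?k * norm w)\<^sup>2"
      using norm_closed_loop_limit Ss s by (intro mult_mono power_mono) auto
    then have "- (c * (norm w)\<^sup>2) \<le> w \<bullet> (riccati S T *v w)"
      using riccati_bounds(2)[OF S, of w T] inner_le[of w riccati_limit] inner_le[of ?y S]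
      unfolding c_def distrib_right power_mult_distrib by (simp add: mult_ac abs_le_iff)
    then show "\<bar>w \<bullet> (riccati S T *v w)\<bar> \<le> c * (norm w)\<^sup>2"
      using riccati_bounds(1)[OF S, of w T] by simp
  qed
qed

lemma modes_bounded_below:
  obtains \<beta> where "\<beta> > 0"
    "\<And>a b. \<beta> * norm a \<le> norm (Xs *v a + Xu *v b) + norm (Ps *v a + Pu *v b)"
proof -
  define f where "f = (\<lambda>(a, b). (Xs *v a + Xu *v b, Ps *v a + Pu *v b))"
  have lin: "linear f"
    by (rule linearI) (auto simp: f_def matrix_vector_right_distrib matrix_vector_mult_scaleR
        scaleR_right_distrib)
  have "inj f"
    unfolding linear_injective_0[OF lin]
  proof clarify
    fix a b
    assume "f (a, b) = 0"
    then have "Xs *v a + Xu *v b = 0" "Ps *v a + Pu *v b = 0"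
      by (simp_all add: f_def zero_prod_def)
    from modes_independent[OF this] show "(a, b) = 0" by (simp add: zero_prod_def)
  qed
  then obtain \<beta> where \<beta>: "\<beta> > 0" "\<And>v. \<beta> * norm v \<le> norm (f v)"
    using linear_inj_bounded_below_pos[OF lin] by blast
  have "\<beta> * norm a \<le> norm (Xs *v a + Xu *v b) + norm (Ps *v a + Pu *v b)" for a b
  proof -
    have "\<beta> * norm a \<le> \<beta> * norm (a, b)"
      using \<beta>(1) norm_fst_le[of a b] by (simp add: mult_left_mono)
    also have "\<dots> \<le> norm (f (a, b))" by (rule \<beta>(2))
    also have "\<dots> \<le> norm (Xs *v a + Xu *v b) + norm (Ps *v a + Pu *v b)"
      by (simp add: f_def norm_Pair_le)
    finally show ?thesis .
  qed
  then show thesis by (rule that[OF \<beta>(1)])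
qed

text \<open>\<open>matrix_inv (initial_state_map S T) *v z\<close> is the stable coordinate of the
  initial pair of \<open>z\<close> and \<open>riccati S T *v z\<close>. The pair is bounded by
  \<open>norm_riccati_le\<close>, its coordinates by independence of the modes.\<close>

lemma norm_initial_coordinate_le:
  assumes s: "0 \<le> s"
  obtains c where "0 \<le> c"
    "\<And>S T z. symmetric_negsemidef S \<Longrightarrow> opnorm S \<le> s \<Longrightarrow>
      norm (matrix_inv (initial_state_map S T) *v z) \<le> c * norm z"
proof -
  obtain \<beta> where \<beta>: "\<beta> > 0"
    "\<And>a b. \<beta> * norm a \<le> norm (Xs *v a + Xu *v b) + norm (Ps *v a + Pu *v b)"
    using modes_bounded_below by blast
  obtain c where c: "0 \<le> c"
    "\<And>S T z. symmetric_negsemidef S \<Longrightarrow> opnorm S \<le> s \<Longrightarrow> norm (riccati S T *v z) \<le> c * norm z"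
    using norm_riccati_le[OF s] by blast
  have bound: "norm (matrix_inv (initial_state_map S T) *v z) \<le> ((1 + c) / \<beta>) * norm z"
    if S: "symmetric_negsemidef S" and Ss: "opnorm S \<le> s" for S T z
  proof -
    define a where "a = matrix_inv (initial_state_map S T) *v z"
    define b where "b = mat_power (matrix_inv Du) T *v unstable_part S T a"
    have "Xs *v a + Xu *v b = z" "Ps *v a + Pu *v b = riccati S T *v z"
      using optimal_boundary(1,2)[OF S, of T z]
      by (simp_all add: optimal_state_def optimal_costate_def Let_def a_def[symmetric]
          mode_state_def mode_costate_def b_def)
    then have "\<beta> * norm a \<le> norm z + c * norm z" using \<beta>(2)[of a b] c(2)[OF S Ss, of T z] by simp
    then show ?thesis using \<beta>(1) by (simp add: a_def field_simps)
  qed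
  have "0 \<le> (1 + c) / \<beta>" using c(1) \<beta>(1) by simp
  then show thesis using bound by (rule that)
qed

text \<open>The norm is continuous in \<open>S\<close> and \<open>x\<close> and positive by
  \<open>invertible_boundary\<close>, so it has a positive minimum over the compact product with the
  unit sphere; homogeneity extends the bound.\<close>

lemma boundary_bounded_below:
  assumes "compact \<S>" and neg: "\<S> \<subseteq> {S. symmetric_negsemidef S}"
  obtains \<eta> where "\<eta> > 0" "\<And>S x. S \<in> \<S> \<Longrightarrow> \<eta> * norm x \<le> norm ((Pu - S ** Xu) *v x)"
proof (cases "\<S> = {}")
  case True
  show thesis by (rule that[of 1]) (use True in auto)
next
  case False
  let ?C = "\<S> \<times> sphere (0 :: real^'d) 1"
  define f where "f v = norm (Pu *v snd v - fst v *v (Xu *v snd v))" for v :: "(real^'d^'d) \<times> (real^'d)"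
  have "compact ?C" using assms(1) by (intro compact_Times compact_sphere)
  moreover have "?C \<noteq> {}" using False by simp
  moreover have "continuous_on ?C f"
    unfolding f_def
    by (intro continuous_on_norm continuous_on_diff continuous_on_fst continuous_on_snd continuous_on_id
        bounded_linear.continuous_on[OF matrix_vector_mul_bounded_linear]
        bounded_bilinear.continuous_on[OF bounded_bilinear_matrix_vector_mult])
  ultimately obtain v where v: "v \<in> ?C" "\<forall>w\<in>?C. f v \<le> f w"
    using continuous_attains_inf[of ?C f] by blast
  have f: "f (S, x) = norm ((Pu - S ** Xu) *v x)" for S x
    by (simp add: f_def matrix_vector_mult_diff_rdistrib matrix_vector_mul_assoc)
  have "f v \<noteq> 0"
  proof
    assume "f v = 0"
    obtain S x where Sx: "v = (S, x)" "S \<in> \<S>" "norm x = 1" using v(1) by auto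
    then have "invertible (Pu - S ** Xu)" using neg invertible_boundary by auto
    then have "matrix_inv (Pu - S ** Xu) *v ((Pu - S ** Xu) *v x) = x"
      by (simp add: matrix_vector_mul_assoc matrix_inv_left)
    moreover have "(Pu - S ** Xu) *v x = 0" using \<open>f v = 0\<close> by (simp add: Sx(1) f)
    ultimately show False using Sx(3) by auto
  qed
  then have pos: "f v > 0" by (simp add: f_def)
  have "f v * norm x \<le> norm ((Pu - S ** Xu) *v x)" if "S \<in> \<S>" for S x
  proof (cases "x = 0")
    case x: False
    have "f v \<le> f (S, inverse (norm x) *\<^sub>R x)" using v(2) that x by simp
    also have "\<dots> = inverse (norm x) * norm ((Pu - S ** Xu) *v x)"
      by (simp add: f matrix_vector_mult_scaleR)
    finally show ?thesis using x by (simp add: field_simps)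
  qed simp
  then show thesis by (rule that[OF pos])
qed

lemma opnorm_bounded_on_compact:
  assumes "compact (\<S> :: (real^'d^'d) set)"
  obtains s where "0 \<le> s" "\<And>S. S \<in> \<S> \<Longrightarrow> opnorm S \<le> s"
proof -
  obtain r where r: "\<And>S. S \<in> \<S> \<Longrightarrow> norm S \<le> r"
    using compact_imp_bounded[OF assms] by (auto simp: bounded_iff)
  obtain k where k: "k > 0" "\<And>S x. norm ((S::real^'d^'d) *v (x::real^'d)) \<le> norm S * norm x * k"
    using bounded_bilinear.pos_bounded[OF bounded_bilinear_matrix_vector_mult] by blast
  have bound: "opnorm S \<le> \<bar>r\<bar> * k" if "S \<in> \<S>" for S
  proof (rule onorm_le)
    fix x :: "real^'d"
    have "norm S * norm x * k \<le> \<bar>r\<bar> * norm x * k"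
      using r[OF that] k(1) by (intro mult_right_mono) auto
    then show "norm (S *v x) \<le> \<bar>r\<bar> * k * norm x" using k(2)[of S x] by (simp add: mult_ac)
  qed
  have "0 \<le> \<bar>r\<bar> * k" using k(1) by simp
  then show thesis using bound by (rule that)
qed

text \<open>With \<open>e\<close> the stable coordinate at time \<open>T\<close>, the vectors
  \<open>Xs *v e\<close> and \<open>Ps *v e\<close> carry the decay, and the unstable part is
  estimated through them. The initial coordinate is bounded uniformly in \<open>T\<close>.\<close>

lemma closed_loop_decay:
  assumes cpt: "compact \<S>" and neg: "\<S> \<subseteq> {S. symmetric_negsemidef S}"
  obtains c where "0 \<le> c"
    "\<And>S T z. S \<in> \<S> \<Longrightarrow> norm (closed_loop S T *v z) \<le> c * exp (- \<gamma> * real T) * norm z"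
proof -
  obtain s where s: "0 \<le> s" "\<And>S. S \<in> \<S> \<Longrightarrow> opnorm S \<le> s"
    using opnorm_bounded_on_compact[OF cpt] by blast
  obtain c where c: "0 \<le> c" "\<And>S T z. symmetric_negsemidef S \<Longrightarrow> opnorm S \<le> s \<Longrightarrow>
      norm (matrix_inv (initial_state_map S T) *v z) \<le> c * norm z"
    using norm_initial_coordinate_le[OF s(1)] by blast
  obtain \<eta> where \<eta>: "\<eta> > 0" "\<And>S x. S \<in> \<S> \<Longrightarrow> \<eta> * norm x \<le> norm ((Pu - S ** Xu) *v x)"
    using boundary_bounded_below[OF assms] by blast
  \<comment> \<open>The first \<open>K\<close> bounds the stable part; the other summand bounds the
    unstable part, obtained from \<open>Ps *v e - S *v (Xs *v e)\<close> with lower bound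
    \<open>\<eta>\<close>.\<close>
  define m where "m = K + opnorm Xu * ((K + s * K) / \<eta>)"
  have m: "0 \<le> m" using K s(1) \<eta>(1) by (simp add: m_def opnorm_nonneg)
  have bound: "norm (closed_loop S T *v z) \<le> m * c * exp (- \<gamma> * real T) * norm z" if "S \<in> \<S>" for S T z
  proof -
    have S: "symmetric_negsemidef S" using that neg by auto
    define a where "a = matrix_inv (initial_state_map S T) *v z"
    define e where "e = mat_power Ds T *v a"
    define q where "q = K * exp (- \<gamma> * real T) * norm a"
    have q0: "0 \<le> q" using K by (simp add: q_def)
    have X: "norm (Xs *v e) \<le> q" and P: "norm (Ps *v e) \<le> q"
      unfolding e_def q_def by (rule norm_Xs, rule norm_Ps)
    have "(Pu - S ** Xu) *v (boundary_map S *v e) = Ps *v e - S *v (Xs *v e)"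
      by (simp add: boundary_map_def matrix_vector_mul_assoc matrix_mul_assoc
          matrix_inv_right[OF invertible_boundary[OF S]] matrix_vector_mult_diff_rdistrib)
    then have "\<eta> * norm (boundary_map S *v e) \<le> norm (Ps *v e - S *v (Xs *v e))"
      using \<eta>(2)[OF that, of "boundary_map S *v e"] by simp
    also have "\<dots> \<le> norm (Ps *v e) + norm (S *v (Xs *v e))" by (rule norm_triangle_ineq4)
    also have "norm (S *v (Xs *v e)) \<le> s * q"
      using order_trans[OF opnorm_ge mult_mono[OF s(2)[OF that] X s(1) norm_ge_zero]] .
    finally have W: "norm (boundary_map S *v e) \<le> (1 + s) * q / \<eta>"
      using P \<eta>(1) by (simp add: field_simps)
    have "closed_loop S T *v z = Xs *v e - Xu *v (boundary_map S *v e)"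
      by (simp add: closed_loop_def e_def a_def matrix_vector_mul_assoc[symmetric]
          matrix_vector_mult_diff_rdistrib)
    then have "norm (closed_loop S T *v z) \<le> norm (Xs *v e) + norm (Xu *v (boundary_map S *v e))"
      by (simp add: norm_triangle_ineq4)
    also have "norm (Xu *v (boundary_map S *v e)) \<le> opnorm Xu * ((1 + s) * q / \<eta>)"
      by (rule order_trans[OF opnorm_ge mult_left_mono[OF W opnorm_nonneg]])
    also note X
    also have "q + opnorm Xu * ((1 + s) * q / \<eta>) = m * exp (- \<gamma> * real T) * norm a"
      by (simp add: m_def q_def algebra_simps add_divide_distrib)
    also have "\<dots> \<le> m * exp (- \<gamma> * real T) * (c * norm z)"
      unfolding a_def using m by (intro mult_left_mono c(2)[OF S s(2)[OF that]]) auto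
    finally show ?thesis by (simp add: mult_ac)
  qed
  show thesis by (rule that[OF mult_nonneg_nonneg[OF m c(1)] bound])
qed

text \<open>The difference identity contains two closed loops, and each contributes one factor
  \<open>exp (- \<gamma> * real T)\<close>.\<close>

lemma riccati_lipschitz:
  assumes cpt: "compact \<S>" and neg: "\<S> \<subseteq> {S. symmetric_negsemidef S}"
  obtains c where "\<And>S S' T. S \<in> \<S> \<Longrightarrow> S' \<in> \<S> \<Longrightarrow>
    opnorm (riccati S T - riccati S' T) \<le> c * exp (- 2 * \<gamma> * real T) * opnorm (S - S')"
proof -
  obtain c where c: "0 \<le> c"
    "\<And>S T z. S \<in> \<S> \<Longrightarrow> norm (closed_loop S T *v z) \<le> c * exp (- \<gamma> * real T) * norm z"
    using closed_loop_decay[OF assms] by blast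
  have "opnorm (riccati S T - riccati S' T) \<le> c\<^sup>2 * exp (- 2 * \<gamma> * real T) * opnorm (S - S')"
    if SS: "S \<in> \<S>" "S' \<in> \<S>" for S S' T
  proof (rule opnorm_le_bilinear)
    fix x y
    let ?e = "exp (- \<gamma> * real T)"
    have S: "symmetric_negsemidef S" "symmetric_negsemidef S'" using SS neg by auto
    have "\<bar>x \<bullet> ((riccati S T - riccati S' T) *v y)\<bar>
        \<le> norm (closed_loop S T *v x) * norm ((S - S') *v (closed_loop S' T *v y))"
      unfolding riccati_difference_inner[OF S] by (rule Cauchy_Schwarz_ineq2)
    also have "\<dots> \<le> (c * ?e * norm x) * (opnorm (S - S') * (c * ?e * norm y))"
      by (intro mult_mono c(2) SS order_trans[OF opnorm_ge] order_refl)
        (use c(1) opnorm_nonneg in auto)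
    also have "\<dots> = c\<^sup>2 * (?e * ?e) * opnorm (S - S') * norm x * norm y"
      by (simp add: power2_eq_square mult_ac)
    also have "?e * ?e = exp (- 2 * \<gamma> * real T)" by (simp add: exp_add[symmetric])
    finally show "\<bar>x \<bullet> ((riccati S T - riccati S' T) *v y)\<bar>
        \<le> c\<^sup>2 * exp (- 2 * \<gamma> * real T) * opnorm (S - S') * norm x * norm y" .
  qed
  then show thesis by (rule that)
qed

abbreviation gain :: "real^'d^'d \<Rightarrow> real^'d^'m"
  where "gain \<equiv> lq_gain A B Q R"

lemma riccati_gain_lipschitz:
  assumes "compact \<S>" and "\<S> \<subseteq> {S. symmetric_negsemidef S}"
  obtains c where "\<And>S S' T. S \<in> \<S> \<Longrightarrow> S' \<in> \<S> \<Longrightarrow>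
    opnorm (riccati S T - riccati S' T) + opnorm (gain (riccati S T) - gain (riccati S' T))
      \<le> c * exp (- 2 * \<gamma> * real T) * opnorm (S - S')"
proof -
  obtain c where c: "\<And>S S' T. S \<in> \<S> \<Longrightarrow> S' \<in> \<S> \<Longrightarrow>
    opnorm (riccati S T - riccati S' T) \<le> c * exp (- 2 * \<gamma> * real T) * opnorm (S - S')"
    using riccati_lipschitz[OF assms] by blast
  \<comment> \<open>The gain is affine in the Riccati matrix with linear part
    \<open>H\<close>.\<close>
  define H where "H = matrix_inv R ** transpose B ** matrix_inv (transpose A)"
  have gain: "gain P - gain P' = H ** (P - P')" for P P'
  proof -
    have "gain P = gain P' + H ** (P - P')"
      unfolding lq_gain_def H_def by (simp add: matrix_add_ldistrib[symmetric] add.commute)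
    then show ?thesis by simp
  qed
  have "opnorm (riccati S T - riccati S' T) + opnorm (gain (riccati S T) - gain (riccati S' T))
      \<le> ((1 + opnorm H) * c) * exp (- 2 * \<gamma> * real T) * opnorm (S - S')"
    if "S \<in> \<S>" "S' \<in> \<S>" for S S' T
  proof -
    let ?d = "opnorm (riccati S T - riccati S' T)"
    have "?d + opnorm (gain (riccati S T) - gain (riccati S' T)) \<le> (1 + opnorm H) * ?d"
      unfolding gain using opnorm_mult[of H "riccati S T - riccati S' T"] by (simp add: distrib_right)
    also have "\<dots> \<le> (1 + opnorm H) * (c * exp (- 2 * \<gamma> * real T) * opnorm (S - S'))"
      using c[OF that, of T] by (intro mult_left_mono) (auto simp: opnorm_nonneg add_nonneg_nonneg)
    finally show ?thesis by (simp add: mult_ac)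
  qed
  then show thesis by (rule that)
qed

section \<open>The stationary branch: existence, uniqueness and initial values\<close>

lemma stationary_branch_ex1:
  assumes S: "symmetric_negsemidef S"
  shows "\<exists>!b. stationary_branch A B Q R S T z b"
proof -
  let ?p = "restrict (optimal_costate S T z) {..T}" and ?x = "restrict (optimal_state S T z) {..T}"
  have "hamiltonian_orbit T ?x ?p"
    using orbit_optimal[of T S z] by (simp add: hamiltonian_orbit_def)
  then have "stationary_branch A B Q R S T z (restrict (feedback ?p) {..<T}, ?x, ?p)"
    by (simp add: stationary_branch_iff optimal_boundary[OF S])
  moreover have "b = b'"
    if "stationary_branch A B Q R S T z b" "stationary_branch A B Q R S T z b'" for b b'
  proof (cases b, cases b')
    fix u x p u' x' p'
    assume b: "b = (u, x, p)" "b' = (u', x', p')"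
    have br: "u \<in> extensional {..<T}" "x \<in> extensional {..T}" "p \<in> extensional {..T}"
      "p T = S *v x T" "hamiltonian_orbit T x p" "\<And>t. t < T \<Longrightarrow> u t = feedback p t"
      "u' \<in> extensional {..<T}" "x' \<in> extensional {..T}" "p' \<in> extensional {..T}"
      "p' T = S *v x' T" "hamiltonian_orbit T x' p'" "\<And>t. t < T \<Longrightarrow> u' t = feedback p' t"
      "x 0 = x' 0"
      using that by (auto simp: b stationary_branch_iff)
    have eq: "x t = x' t \<and> p t = p' t" if "t \<le> T" for t
      using orbit_unique[OF br(5) br(11) S br(4) br(10) br(13) that] .
    have "x = x'" using eq by (intro extensionalityI[OF br(2) br(8)]) auto
    moreover have "p = p'" using eq by (intro extensionalityI[OF br(3) br(9)]) auto
    moreover have "u = u'"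
      using br(6) br(12) \<open>p = p'\<close> by (intro extensionalityI[OF br(1) br(7)]) auto
    ultimately show "b = b'" by (simp add: b)
  qed
  ultimately show ?thesis by blast
qed

text \<open>Uniqueness identifies the branch with the combination of modes. The first control reads
  the costate at time 1, which the costate equation at time 0 recovers from \<open>p 0\<close> and
  \<open>z\<close>; this step exists because \<open>1 \<le> T\<close>.\<close>

lemma stationary_branch_initial:
  assumes S: "symmetric_negsemidef S" and T: "1 \<le> T"
    and br: "stationary_branch A B Q R S T z (u, x, p)"
  shows "p 0 = riccati S T *v z" and "u 0 = gain (riccati S T) *v z"
proof -
  have x: "hamiltonian_orbit T x p" "p T = S *v x T" "x 0 = z" and u: "u 0 = feedback p 0"
    using br T by (auto simp: stationary_branch_iff)
  show p0: "p 0 = riccati S T *v z"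
    using orbit_unique[OF x(1) orbit_optimal[of T S z] S x(2), of 0] x(3)
    by (simp add: optimal_boundary[OF S])
  have "matrix_inv (transpose A) *v (transpose A *v p (Suc 0)) = p (Suc 0)"
    by (simp add: matrix_vector_mul_assoc matrix_inv_left[OF transpose_invertible[OF A]])
  then have "p (Suc 0) = matrix_inv (transpose A) *v (riccati S T *v z + Q *v z)"
    using orbit_stepD(2)[OF x(1), of 0] T by (simp add: p0 x(3))
  then show "u 0 = gain (riccati S T) *v z"
    by (simp add: u lq_gain_def matrix_vector_mul_assoc[symmetric] matrix_vector_mult_add_rdistrib)
qed

end

theorem corollary6p3:
  fixes A Q :: "real^'d^'d" and B :: "real^'m^'d" and R :: "real^'m^'m"
    and Xs Ps Xu Pu Ds Du :: "real^'d^'d" and K \<gamma> :: real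
  assumes A: "invertible A"
    and Q: "symmetric_posdef Q"
    and R: "symmetric_posdef R"
    and AB: "stabilizable A B"
    and Vs: "columns_basis_of (vcat Xs Ps) (stable_subspace (hamiltonian_step A B Q R))"
    and Vu: "columns_basis_of (vcat Xu Pu) (unstable_subspace (hamiltonian_step A B Q R))"
    and Ds: "hamiltonian_step A B Q R ** vcat Xs Ps = vcat Xs Ps ** Ds"
    and Du: "hamiltonian_step A B Q R ** vcat Xu Pu = vcat Xu Pu ** Du"
    and K: "K \<ge> 1" and \<gamma>: "\<gamma> > 0"
    and decay_s: "\<And>k. opnorm (vcat Xs Ps ** mat_power Ds k) \<le> K * exp (- \<gamma> * real k)"
    and decay_u: "\<And>k. opnorm (vcat Xu Pu ** mat_power (matrix_inv Du) k)
                       \<le> K * exp (- \<gamma> * real k)"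
  shows "\<exists>(PT :: nat \<Rightarrow> real^'d^'d \<Rightarrow> real^'d^'d) (KT :: nat \<Rightarrow> real^'d^'d \<Rightarrow> real^'d^'m).
    invertible Xs \<and> invertible Du \<and>
    (\<forall>S T. symmetric_negsemidef S \<longrightarrow> 1 \<le> T \<longrightarrow>
       \<comment> \<open>optimality of the stationary branch, value and first control\<close>
       transpose (PT T S) = PT T S \<and>
       (\<forall>x. (\<exists>!b. stationary_branch A B Q R S T x b)) \<and>
       (\<forall>U x u \<xi> p.
          stationary_branch A B Q R S T x (u, \<xi>, p) \<longrightarrow>
          U = UNIV \<or> (\<exists>w. lq_optimal A B Q R S U T x w \<and> (\<forall>t<T. w t \<in> interior U)) \<longrightarrow>
            (\<forall>w. lq_optimal A B Q R S U T x w \<longleftrightarrow> w = u) \<and>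
            lq_value A B Q R S U T x = 1/2 * (x \<bullet> (PT T S *v x)) \<and>
            lq_first_control A B Q R S U T x = KT T S *v x) \<and>
       \<comment> \<open>closed formulas\<close>
       invertible (Pu - S ** Xu) \<and>
       invertible (Xs - Xu ** ric_error Xs Ps Xu Pu Ds Du S T) \<and>
       PT T S = (Ps - Pu ** ric_error Xs Ps Xu Pu Ds Du S T)
                ** matrix_inv (Xs - Xu ** ric_error Xs Ps Xu Pu Ds Du S T) \<and>
       KT T S = lq_gain A B Q R (PT T S)) \<and>
    \<comment> \<open>convergence to the infinite-horizon matrices\<close>
    (\<forall>S. symmetric_negsemidef S \<longrightarrow>
       (\<exists>C. \<forall>T\<ge>1.
          opnorm (PT T S - Ps ** matrix_inv Xs)
          + opnorm (KT T S - lq_gain A B Q R (Ps ** matrix_inv Xs))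
          \<le> C * exp (- 2 * \<gamma> * real T))) \<and>
    \<comment> \<open>dependence on the terminal Hessian, uniform on compact sets\<close>
    (\<forall>\<S>. compact \<S> \<and> \<S> \<subseteq> {S. symmetric_negsemidef S} \<longrightarrow>
       (\<exists>C. \<forall>S\<in>\<S>. \<forall>S'\<in>\<S>. \<forall>T\<ge>1.
          opnorm (PT T S - PT T S') + opnorm (KT T S - KT T S')
          \<le> C * exp (- 2 * \<gamma> * real T) * opnorm (S - S'))) \<and>
    (\<forall>S S'. symmetric_negsemidef S \<longrightarrow> symmetric_negsemidef S' \<longrightarrow>
       (\<lambda>T. opnorm (PT T S - PT T S')) \<in> O(\<lambda>T. exp (- 2 * \<gamma> * real T)) \<and>
       (\<lambda>T. opnorm (KT T S - KT T S')) \<in> O(\<lambda>T. exp (- 2 * \<gamma> * real T)))"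
proof -
  interpret lq_dichotomy A Q B R Xs Ps Xu Pu Ds Du K \<gamma>
    by unfold_locales (fact A Q R AB Ds Du K \<gamma> decay_s decay_u
        columns_basis_of_inj[OF Vs] columns_basis_of_inj[OF Vu])+
  have optimality: "(\<forall>w. lq_optimal A B Q R S U T x w \<longleftrightarrow> w = u) \<and>
      lq_value A B Q R S U T x = 1/2 * (x \<bullet> (riccati S T *v x)) \<and>
      lq_first_control A B Q R S U T x = gain (riccati S T) *v x"
    if S: "symmetric_negsemidef S" and T: "1 \<le> T"
      and br: "stationary_branch A B Q R S T x (u, \<xi>, p)"
      and U: "U = UNIV \<or> (\<exists>w. lq_optimal A B Q R S U T x w \<and> (\<forall>t<T. w t \<in> interior U))"
    for S T U x u \<xi> p
    using stationary_branch_optimal[OF br S U] stationary_branch_initial[OF S T br]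
    by (simp add: lq_first_control_def inner_commute)
  have pair: "\<exists>C. \<forall>T. opnorm (riccati S T - riccati S' T)
      + opnorm (gain (riccati S T) - gain (riccati S' T)) \<le> C * exp (- 2 * \<gamma> * real T)"
    if "symmetric_negsemidef S" "symmetric_negsemidef S'" for S S'
  proof -
    \<comment> \<open>A two-point set is compact; the distance of its points goes into the
      constant.\<close>
    have "compact {S, S'}" by (simp add: finite_imp_compact)
    moreover have "{S, S'} \<subseteq> {S. symmetric_negsemidef S}" using that by simp
    ultimately obtain c where c: "\<And>S1 S2 T. S1 \<in> {S, S'} \<Longrightarrow> S2 \<in> {S, S'} \<Longrightarrow>
      opnorm (riccati S1 T - riccati S2 T) + opnorm (gain (riccati S1 T) - gain (riccati S2 T))
        \<le> c * exp (- 2 * \<gamma> * real T) * opnorm (S1 - S2)"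
      using riccati_gain_lipschitz by blast
    show ?thesis
    proof (intro exI allI)
      fix T
      show "opnorm (riccati S T - riccati S' T) + opnorm (gain (riccati S T) - gain (riccati S' T))
          \<le> (c * opnorm (S - S')) * exp (- 2 * \<gamma> * real T)"
        using c[of S S' T] by (simp add: mult_ac)
    qed
  qed
  have bigo: "(\<lambda>T. opnorm (riccati S T - riccati S' T)) \<in> O(\<lambda>T. exp (- 2 * \<gamma> * real T)) \<and>
      (\<lambda>T. opnorm (gain (riccati S T) - gain (riccati S' T))) \<in> O(\<lambda>T. exp (- 2 * \<gamma> * real T))"
    if S: "symmetric_negsemidef S" "symmetric_negsemidef S'" for S S'
  proof -
    obtain C where C: "\<And>T. opnorm (riccati S T - riccati S' T)
        + opnorm (gain (riccati S T) - gain (riccati S' T)) \<le> C * exp (- 2 * \<gamma> * real T)"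
      using pair[OF S] by blast
    have "\<bar>opnorm (riccati S T - riccati S' T)\<bar> \<le> C * exp (- 2 * \<gamma> * real T)"
      "\<bar>opnorm (gain (riccati S T) - gain (riccati S' T))\<bar> \<le> C * exp (- 2 * \<gamma> * real T)" for T
      using C[of T] opnorm_nonneg[of "riccati S T - riccati S' T"]
        opnorm_nonneg[of "gain (riccati S T) - gain (riccati S' T)"]
      by linarith+
    then show ?thesis by (intro conjI bigoI[of _ C] always_eventually) simp_all
  qed
  show ?thesis
  proof (intro exI[of _ "\<lambda>T S. riccati S T"] exI[of _ "\<lambda>T S. gain (riccati S T)"] conjI allI impI)
    fix S :: "real^'d^'d" and T :: nat
    assume S: "symmetric_negsemidef S" and T: "1 \<le> T"
    show "transpose (riccati S T) = riccati S T" by (rule riccati_symmetric[OF S])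
    show "\<exists>!b. stationary_branch A B Q R S T x b" for x by (rule stationary_branch_ex1[OF S])
    show "lq_optimal A B Q R S U T x w \<longleftrightarrow> w = u"
      "lq_value A B Q R S U T x = 1/2 * (x \<bullet> (riccati S T *v x))"
      "lq_first_control A B Q R S U T x = gain (riccati S T) *v x"
      if "stationary_branch A B Q R S T x (u, \<xi>, p)"
        and "U = UNIV \<or> (\<exists>w. lq_optimal A B Q R S U T x w \<and> (\<forall>t<T. w t \<in> interior U))"
      for U x u \<xi> p w
      using optimality[OF S T that] by blast+
    show "invertible (Pu - S ** Xu)" by (rule invertible_boundary[OF S])
    show "invertible (Xs - Xu ** ric_error Xs Ps Xu Pu Ds Du S T)"
      using invertible_initial_state_map[OF S, of T] by (simp add: initial_state_map_def)
    show "riccati S T = (Ps - Pu ** ric_error Xs Ps Xu Pu Ds Du S T)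
        ** matrix_inv (Xs - Xu ** ric_error Xs Ps Xu Pu Ds Du S T)"
      by (simp add: riccati_def initial_state_map_def)
  next
    fix S :: "real^'d^'d"
    assume S: "symmetric_negsemidef S"
    \<comment> \<open>Since \<open>riccati_limit\<close> is an admissible terminal matrix reproduced
      at every horizon, convergence is the pair estimate for \<open>S\<close> and
      \<open>riccati_limit\<close>.\<close>
    show "\<exists>C. \<forall>T\<ge>1. opnorm (riccati S T - riccati_limit)
        + opnorm (gain (riccati S T) - gain riccati_limit) \<le> C * exp (- 2 * \<gamma> * real T)"
      using pair[OF S riccati_limit_negsemidef] unfolding riccati_limit_fixed(1) by blast
  next
    fix \<S> :: "(real^'d^'d) set"
    assume "compact \<S> \<and> \<S> \<subseteq> {S. symmetric_negsemidef S}"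
    then obtain c where "\<And>S S' T. S \<in> \<S> \<Longrightarrow> S' \<in> \<S> \<Longrightarrow>
      opnorm (riccati S T - riccati S' T) + opnorm (gain (riccati S T) - gain (riccati S' T))
        \<le> c * exp (- 2 * \<gamma> * real T) * opnorm (S - S')"
      using riccati_gain_lipschitz[of \<S>] by blast
    then show "\<exists>C. \<forall>S\<in>\<S>. \<forall>S'\<in>\<S>. \<forall>T\<ge>1.
        opnorm (riccati S T - riccati S' T) + opnorm (gain (riccati S T) - gain (riccati S' T))
        \<le> C * exp (- 2 * \<gamma> * real T) * opnorm (S - S')"
      by blast
  next
    fix S S' :: "real^'d^'d"
    assume "symmetric_negsemidef S" "symmetric_negsemidef S'"
    note bigo[OF this]
    then show "(\<lambda>T. opnorm (riccati S T - riccati S' T)) \<in> O(\<lambda>T. exp (- 2 * \<gamma> * real T))"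
      "(\<lambda>T. opnorm (gain (riccati S T) - gain (riccati S' T))) \<in> O(\<lambda>T. exp (- 2 * \<gamma> * real T))"
      by blast+
  next
    show "gain (riccati S T) = gain (riccati S T)" for S T by (rule refl)
  qed (fact invertible_Xs invertible_Du)+
qed

end
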